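(* Let $n\ge 1$ and let $\bar\alpha,\bar k$ be two smooth real functions on an interval $I$ which satisfy the following integrability condition: for a suitable choice of the antiderivative $\int\bar\alpha\,ds$, the functions $$x(s)=e^{\int\bar\alpha\,ds},\qquad t(s)=-\int\bar k(s)\,x(s)^2\,ds$$ satisfy $$\frac{(x x')^2+(t')^2}{x^2}=1\quad\text{on } I,\qquad {}'=\frac{d}{ds}.$$ Then there exists a rotationally symmetric hypersurface in the Heisenberg group $H_n$, generated by a curve parametrized by $s\in I$, such that $\alpha(s)=\bar\alpha(s)$ and $k(s)=\bar k(s)$ for all $s\in I$, and $s$ is the horizontal arc-length. In addition, such a hypersurface is unique up to a Heisenberg rigid motion, and its generating curve on the $x_nt$-plane is $$x(s)=e^{\int\bar\alpha\,ds},\qquad t(s)=-\int\bar k\,x^2\,ds,$$ which is uniquely defined up to a translation along the $t$-axis.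
   Context: The Heisenberg group $H_n$ is $\mathbb R^{2n+1}$ with coordinates $(x_1,\dots,x_n,y_1,\dots,y_n,t)$, $z=(x_1+iy_1,\dots,x_n+iy_n)$, group law $(x,y,t)\circ(x',y',t')=(x+x',y+y',t+t'+\sum_j(y_jx_j'-x_jy_j'))$, contact form $\Theta=dt+\sum_{j}(x_jdy_j-y_jdx_j)$, contact bundle $\xi=\ker\Theta$, and left-invariant fields $\mathring e_\beta=\partial_{x_\beta}+y_\beta\partial_t$, $\mathring e_{n+\beta}=\partial_{y_\beta}-x_\beta\partial_t$ ($1\le\beta\le n$), $T=\partial_t$. $J:\xi\to\xi$ is defined by $J\mathring e_\beta=\mathring e_{n+\beta}$, $J\mathring e_{n+\beta}=-\mathring e_\beta$; the Levi metric $G$ on $\xi$ makes $\mathring e_1,\dots,\mathring e_{2n}$ orthonormal; the pseudohermitian connection $\nabla$ is the flat one for which all $\mathring e_a$ and $T$ are parallel. Heisenberg rigid motions are the elements of $PSH(n)$, the group generated by left translations and the maps $(z,t)\mapsto(Az,t)$, $A\in U(n)$. A rotationally symmetric hypersurface is one invariant under $U(n)$. It is generated by a smooth regular curve $(x(s),t(s))$, $x>0$, in the $x_nt$-plane: $\Sigma=\{(z,t):(|z|,t)=(x(s),t(s))\text{ for some }s\}$. The horizontal generating curve is $\tilde\gamma(s)=(0,\dots,0,x\cos\theta(s),0,\dots,0,x\sin\theta(s),t(s))$ (in the $x_ny_nt$-space), with $\theta'=-t'/x^2$, so that $\tilde\gamma'\in\xi$. The parameter $s$ is the horizontal arc-length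 if $|\tilde\gamma'|_G=1$, i.e. $(x')^2+(t')^2/x^2=1$. Invariants. At a regular point of $\Sigma$ ($\xi\ne T\Sigma$; all points with $x>0$ are regular) let $\xi'=(\xi\cap T\Sigma)\cap J(\xi\cap T\Sigma)$, let $e_n\in\xi\cap T\Sigma$ be the unit vector $G$-orthogonal to $\xi'$ with orientation given by $\tilde\gamma'$ (extended by rotation), and $e_{2n}=Je_n$. The function $\alpha$ is defined by $\alpha e_{2n}+T\in T\Sigma$. For $n\ge2$, $k$ is the common eigenvalue on $\xi'$ of the shape operator $\mathfrak S(v)=-\nabla_ve_{2n}+\alpha J'v$, where $J'=J$ on $\xi'$ and $J'e_n=0$ (rotationally symmetric hypersurfaces are umbilic, so this common eigenvalue exists). For $n=1$, $k$ is defined by the same formula that holds for $n\ge2$, $k=\dfrac{-t'}{x\sqrt{(xx')^2+(t')^2}}$. By symmetry $\alpha,k$ are functions of $s$. *)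

theory Defs
  imports "HOL-Analysis.Analysis" "HOL-Algebra.Bij" "HOL-Algebra.Generated_Groups"
begin

section \<open>Smooth functions on an interval\<close>

text \<open>The interval may contain end points; derivatives there are one-sided.\<close>

definition smooth_on_interval :: "real set \<Rightarrow> (real \<Rightarrow> real) \<Rightarrow> bool" where
  "smooth_on_interval I f \<longleftrightarrow>
     (\<exists>D :: nat \<Rightarrow> real \<Rightarrow> real. D 0 = f \<and>
        (\<forall>m. \<forall>s\<in>I. (D m has_real_derivative D (Suc m) s) (at s within I)))"

abbreviation deriv_in :: "real set \<Rightarrow> (real \<Rightarrow> 'a::real_normed_vector) \<Rightarrow> real \<Rightarrow> 'a" where
  "deriv_in I f s \<equiv> vector_derivative f (at s within I)"


section \<open>The Heisenberg group\<close>

text \<open>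
  A point is a pair \<open>(z, t)\<close> with \<open>z $ j = x\<^sub>j + \<i> y\<^sub>j\<close>, and \<open>n\<close> is \<open>CARD('n)\<close>. A tangent vector is
  given by its Euclidean components, in the same format: \<open>(w, h)\<close> stands for
  \<open>\<Sum>j. Re (w $ j) \<partial>/\<partial>x\<^sub>j + Im (w $ j) \<partial>/\<partial>y\<^sub>j\<close> plus \<open>h \<partial>/\<partial>t\<close>.
\<close>

type_synonym 'n heis = "(complex ^ 'n) \<times> real"

definition heis_mult :: "'n::finite heis \<Rightarrow> 'n heis \<Rightarrow> 'n heis" where
  "heis_mult p q =
     (fst p + fst q,
      snd p + snd q + (\<Sum>j\<in>UNIV. Im (fst p $ j) * Re (fst q $ j) - Re (fst p $ j) * Im (fst q $ j)))"

definition contact_form :: "'n::finite heis \<Rightarrow> 'n heis \<Rightarrow> real" where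
  "contact_form p v =
     snd v + (\<Sum>j\<in>UNIV. Re (fst p $ j) * Im (fst v $ j) - Im (fst p $ j) * Re (fst v $ j))"

definition contact_plane :: "'n::finite heis \<Rightarrow> 'n heis set" where
  "contact_plane p = {v. contact_form p v = 0}"

text \<open>The left-invariant fields \<open>\<partial>/\<partial>x\<^sub>\<beta> + y\<^sub>\<beta> \<partial>/\<partial>t\<close>, \<open>\<partial>/\<partial>y\<^sub>\<beta> - x\<^sub>\<beta> \<partial>/\<partial>t\<close> and \<open>\<partial>/\<partial>t\<close>.\<close>

definition frame_x :: "'n::finite \<Rightarrow> 'n heis \<Rightarrow> 'n heis" where
  "frame_x \<beta> p = (axis \<beta> 1, Im (fst p $ \<beta>))"

definition frame_y :: "'n::finite \<Rightarrow> 'n heis \<Rightarrow> 'n heis" where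
  "frame_y \<beta> p = (axis \<beta> \<i>, - Re (fst p $ \<beta>))"

definition frame_T :: "'n::finite heis" where
  "frame_T = (0, 1)"

text \<open>
  Frame coefficients: \<open>v\<close> is the combination of \<open>frame_x \<beta> p\<close>, \<open>frame_y \<beta> p\<close> and \<open>frame_T\<close> with
  coefficients \<open>Re (fst v $ \<beta>)\<close>, \<open>Im (fst v $ \<beta>)\<close> and \<open>contact_form p v\<close>; see
  \<open>from_frame_frame_coeffs\<close> below.
\<close>

definition frame_coeffs :: "'n::finite heis \<Rightarrow> 'n heis \<Rightarrow> (complex ^ 'n) \<times> real" where
  "frame_coeffs p v = (fst v, contact_form p v)"

definition from_frame :: "'n::finite heis \<Rightarrow> (complex ^ 'n) \<times> real \<Rightarrow> 'n heis" where
  "from_frame p a =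
     (\<Sum>\<beta>\<in>UNIV. Re (fst a $ \<beta>) *\<^sub>R frame_x \<beta> p + Im (fst a $ \<beta>) *\<^sub>R frame_y \<beta> p) + snd a *\<^sub>R frame_T"

definition heis_J :: "'n::finite heis \<Rightarrow> 'n heis \<Rightarrow> 'n heis" where
  "heis_J p v =
     (\<Sum>\<beta>\<in>UNIV. Re (fst v $ \<beta>) *\<^sub>R frame_y \<beta> p - Im (fst v $ \<beta>) *\<^sub>R frame_x \<beta> p)"

definition levi_metric :: "'n::finite heis \<Rightarrow> 'n heis \<Rightarrow> 'n heis \<Rightarrow> real" where
  "levi_metric p v w =
     (\<Sum>\<beta>\<in>UNIV. Re (fst v $ \<beta>) * Re (fst w $ \<beta>) + Im (fst v $ \<beta>) * Im (fst w $ \<beta>))"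

text \<open>
  \<open>\<nabla>\<close> along a curve \<open>c\<close>, at its starting time \<open>0\<close>: the frame fields are parallel, so the frame
  coefficients of the field \<open>W\<close> along \<open>c\<close> are differentiated.
\<close>

definition cov_deriv :: "(real \<Rightarrow> 'n::finite heis) \<Rightarrow> (real \<Rightarrow> 'n heis) \<Rightarrow> 'n heis" where
  "cov_deriv c W =
     from_frame (c 0) (vector_derivative (\<lambda>u. frame_coeffs (c u) (W u)) (at_right 0))"

lemma from_frame_eq:
  "from_frame p a = (fst a, snd a - contact_form p (fst a, 0))" for p :: "'n::finite heis"
proof -
  have "(\<Sum>\<beta>\<in>UNIV. Re (fst a $ \<beta>) *\<^sub>R axis \<beta> (1::complex) + Im (fst a $ \<beta>) *\<^sub>R axis \<beta> \<i>) $ i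
      = fst a $ i" for i
  proof -
    have "(\<Sum>\<beta>\<in>UNIV. Re (fst a $ \<beta>) *\<^sub>R axis \<beta> (1::complex) + Im (fst a $ \<beta>) *\<^sub>R axis \<beta> \<i>) $ i
        = (\<Sum>\<beta>\<in>UNIV. if \<beta> = i then fst a $ i else 0)"
      unfolding sum_component
      by (rule sum.cong) (auto simp: axis_def complex_eq_iff)
    then show ?thesis by simp
  qed
  then show ?thesis
    by (simp add: from_frame_def frame_x_def frame_y_def frame_T_def contact_form_def prod_eq_iff
        fst_sum snd_sum vec_eq_iff sum_subtractf mult.commute)
qed

lemma from_frame_frame_coeffs: "from_frame p (frame_coeffs p v) = v"
  by (simp add: from_frame_eq frame_coeffs_def contact_form_def prod_eq_iff)

lemma frame_in_contact_plane:
  "frame_x \<beta> p \<in> contact_plane p" "frame_y \<beta> p \<in> contact_plane p"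
proof -
  have "(\<Sum>j\<in>UNIV. Re (fst p $ j) * Im (axis \<beta> 1 $ j) - Im (fst p $ j) * Re (axis \<beta> 1 $ j))
      = (\<Sum>j\<in>UNIV. if j = \<beta> then - Im (fst p $ \<beta>) else 0)"
    by (rule sum.cong) (auto simp: axis_def)
  then show "frame_x \<beta> p \<in> contact_plane p"
    by (simp add: contact_plane_def contact_form_def frame_x_def)
  have "(\<Sum>j\<in>UNIV. Re (fst p $ j) * Im (axis \<beta> \<i> $ j) - Im (fst p $ j) * Re (axis \<beta> \<i> $ j))
      = (\<Sum>j\<in>UNIV. if j = \<beta> then Re (fst p $ \<beta>) else 0)"
    by (rule sum.cong) (auto simp: axis_def)
  then show "frame_y \<beta> p \<in> contact_plane p"
    by (simp add: contact_plane_def contact_form_def frame_y_def)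
qed

lemma heis_J_frame:
  "heis_J p (frame_x \<beta> p) = frame_y \<beta> p" "heis_J p (frame_y \<beta> p) = - frame_x \<beta> p"
proof -
  have "heis_J p (frame_x \<beta> p) = (\<Sum>b\<in>UNIV. if b = \<beta> then frame_y \<beta> p else 0)"
    unfolding heis_J_def by (rule sum.cong) (auto simp: frame_x_def axis_def zero_prod_def[symmetric])
  then show "heis_J p (frame_x \<beta> p) = frame_y \<beta> p" by simp
  have "heis_J p (frame_y \<beta> p) = (\<Sum>b\<in>UNIV. if b = \<beta> then - frame_x \<beta> p else 0)"
    unfolding heis_J_def by (rule sum.cong) (auto simp: frame_y_def axis_def zero_prod_def[symmetric])
  then show "heis_J p (frame_y \<beta> p) = - frame_x \<beta> p" by simp
qed


section \<open>Heisenberg rigid motions\<close>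

definition unitary :: "complex ^ 'n::finite ^ 'n \<Rightarrow> bool" where
  "unitary A \<longleftrightarrow> A ** (\<chi> i j. cnj (A $ j $ i)) = mat 1 \<and> (\<chi> i j. cnj (A $ j $ i)) ** A = mat 1"

definition unitary_map :: "complex ^ 'n::finite ^ 'n \<Rightarrow> 'n heis \<Rightarrow> 'n heis" where
  "unitary_map A p = (A *v fst p, snd p)"

definition PSH :: "('n::finite heis \<Rightarrow> 'n heis) set" where
  "PSH = generate (BijGroup UNIV) (range heis_mult \<union> {unitary_map A | A. unitary A})"


section \<open>Rotationally symmetric hypersurfaces\<close>

definition U_invariant :: "'n::finite heis set \<Rightarrow> bool" where
  "U_invariant S \<longleftrightarrow> (\<forall>A. unitary A \<longrightarrow> unitary_map A ` S = S)"

definition generating_curve :: "real set \<Rightarrow> (real \<Rightarrow> real) \<Rightarrow> (real \<Rightarrow> real) \<Rightarrow> bool" where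
  "generating_curve I x t \<longleftrightarrow>
     smooth_on_interval I x \<and> smooth_on_interval I t \<and>
     (\<forall>s\<in>I. x s > 0 \<and> (deriv_in I x s, deriv_in I t s) \<noteq> (0, 0))"

definition rot_hypersurface ::
    "real set \<Rightarrow> (real \<Rightarrow> real) \<Rightarrow> (real \<Rightarrow> real) \<Rightarrow> 'n::finite heis set \<Rightarrow> bool" where
  "rot_hypersurface I x t S \<longleftrightarrow>
     generating_curve I x t \<and> U_invariant S \<and>
     S = {p. \<exists>s\<in>I. (norm (fst p), snd p) = (x s, t s)}"

text \<open>
  The generating curve may have self-intersections, so the hypersurface is treated as immersed: a
  point of it is a pair \<open>(s, \<omega>)\<close> with \<open>s \<in> I\<close> and \<open>\<omega>\<close> in the unit sphere of complex \<open>n\<close>-space.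
\<close>

definition rot_param ::
    "(real \<Rightarrow> real) \<Rightarrow> (real \<Rightarrow> real) \<Rightarrow> real \<times> (complex ^ 'n::finite) \<Rightarrow> 'n heis" where
  "rot_param x t q = (x (fst q) *\<^sub>R snd q, t (fst q))"

text \<open>
  \<open>c\<close> is a curve in the parameter manifold, starting at \<open>(s, \<omega>)\<close>, whose image in the hypersurface
  has initial velocity \<open>v\<close>. Velocities are one-sided so that end points of \<open>I\<close> are covered; for the
  same reason the tangent space is the span of the velocities.
\<close>

definition surface_curve :: "real set \<Rightarrow> (real \<Rightarrow> real) \<Rightarrow> (real \<Rightarrow> real) \<Rightarrow> real \<Rightarrow> complex ^ 'n::finite \<Rightarrow>
    (real \<Rightarrow> real \<times> (complex ^ 'n)) \<Rightarrow> 'n heis \<Rightarrow> bool" where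
  "surface_curve I x t s \<omega> c v \<longleftrightarrow>
     c 0 = (s, \<omega>) \<and> (\<forall>\<^sub>F u in at_right 0. c u \<in> I \<times> sphere 0 1) \<and>
     c differentiable (at_right 0) \<and>
     ((\<lambda>u. rot_param x t (c u)) has_vector_derivative v) (at_right 0)"

definition tangent_space :: "real set \<Rightarrow> (real \<Rightarrow> real) \<Rightarrow> (real \<Rightarrow> real) \<Rightarrow> real \<Rightarrow> complex ^ 'n::finite \<Rightarrow>
    'n heis set" where
  "tangent_space I x t s \<omega> = span {v. \<exists>c. surface_curve I x t s \<omega> c v}"

definition horizontal_tangent :: "real set \<Rightarrow> (real \<Rightarrow> real) \<Rightarrow> (real \<Rightarrow> real) \<Rightarrow> real \<Rightarrow>
    complex ^ 'n::finite \<Rightarrow> 'n heis set" where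
  "horizontal_tangent I x t s \<omega> =
     contact_plane (rot_param x t (s, \<omega>)) \<inter> tangent_space I x t s \<omega>"

definition xi' :: "real set \<Rightarrow> (real \<Rightarrow> real) \<Rightarrow> (real \<Rightarrow> real) \<Rightarrow> real \<Rightarrow> complex ^ 'n::finite \<Rightarrow>
    'n heis set" where
  "xi' I x t s \<omega> =
     horizontal_tangent I x t s \<omega> \<inter>
     heis_J (rot_param x t (s, \<omega>)) ` horizontal_tangent I x t s \<omega>"

text \<open>
  The horizontal generating curve in the \<open>x\<^sub>n y\<^sub>n t\<close>-space is the case \<open>\<omega> = axis n 1\<close>; for the other
  unit vectors \<open>\<omega>\<close> one gets its images under the unitary group.
\<close>

definition horizontal_angle ::
    "real set \<Rightarrow> (real \<Rightarrow> real) \<Rightarrow> (real \<Rightarrow> real) \<Rightarrow> (real \<Rightarrow> real) \<Rightarrow> bool" where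
  "horizontal_angle I x t \<theta> \<longleftrightarrow>
     (\<forall>s\<in>I. (\<theta> has_real_derivative - deriv_in I t s / (x s)\<^sup>2) (at s within I))"

definition horizontal_curve :: "(real \<Rightarrow> real) \<Rightarrow> (real \<Rightarrow> real) \<Rightarrow> (real \<Rightarrow> real) \<Rightarrow> complex ^ 'n::finite \<Rightarrow>
    real \<Rightarrow> 'n heis" where
  "horizontal_curve x t \<theta> \<omega> s = (x s *\<^sub>R (cis (\<theta> s) *s \<omega>), t s)"

definition horizontal_arclength ::
    "'n::finite itself \<Rightarrow> real set \<Rightarrow> (real \<Rightarrow> real) \<Rightarrow> (real \<Rightarrow> real) \<Rightarrow> bool" where
  "horizontal_arclength _ I x t \<longleftrightarrow>
     (\<exists>\<theta>. horizontal_angle I x t \<theta> \<and>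
        (\<forall>s\<in>I. \<forall>\<omega> :: complex ^ 'n \<in> sphere 0 1.
           let v = deriv_in I (horizontal_curve x t \<theta> \<omega>) s
           in sqrt (levi_metric (horizontal_curve x t \<theta> \<omega> s) v v) = 1))"


section \<open>The invariants \<open>\<alpha>\<close> and \<open>k\<close>\<close>

text \<open>
  The angle is normalised by \<open>\<theta> s = 0\<close>, so that the horizontal curve used for the orientation
  passes through the point with parameters \<open>(s, \<omega>)\<close>.
\<close>

definition e_n :: "real set \<Rightarrow> (real \<Rightarrow> real) \<Rightarrow> (real \<Rightarrow> real) \<Rightarrow> real \<Rightarrow> complex ^ 'n::finite \<Rightarrow>
    'n heis" where
  "e_n I x t s \<omega> =
     (let p = rot_param x t (s, \<omega>) in
      THE v. v \<in> horizontal_tangent I x t s \<omega> \<and>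
             (\<forall>w\<in>xi' I x t s \<omega>. levi_metric p v w = 0) \<and>
             levi_metric p v v = 1 \<and>
             (\<exists>\<theta>. horizontal_angle I x t \<theta> \<and> \<theta> s = 0 \<and>
                  levi_metric p v (deriv_in I (horizontal_curve x t \<theta> \<omega>) s) > 0))"

definition e_2n :: "real set \<Rightarrow> (real \<Rightarrow> real) \<Rightarrow> (real \<Rightarrow> real) \<Rightarrow> real \<Rightarrow> complex ^ 'n::finite \<Rightarrow>
    'n heis" where
  "e_2n I x t s \<omega> = heis_J (rot_param x t (s, \<omega>)) (e_n I x t s \<omega>)"

definition alpha :: "'n::finite itself \<Rightarrow> real set \<Rightarrow> (real \<Rightarrow> real) \<Rightarrow> (real \<Rightarrow> real) \<Rightarrow> real \<Rightarrow> real" where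
  "alpha _ I x t s =
     (THE a. \<forall>\<omega> :: complex ^ 'n \<in> sphere 0 1.
        a *\<^sub>R e_2n I x t s \<omega> + frame_T \<in> tangent_space I x t s \<omega>)"

definition J' :: "real set \<Rightarrow> (real \<Rightarrow> real) \<Rightarrow> (real \<Rightarrow> real) \<Rightarrow> real \<Rightarrow> complex ^ 'n::finite \<Rightarrow>
    'n heis \<Rightarrow> 'n heis" where
  "J' I x t s \<omega> v =
     (let p = rot_param x t (s, \<omega>); e = e_n I x t s \<omega>
      in heis_J p (v - levi_metric p v e *\<^sub>R e))"

text \<open>
  The shape operator differentiates \<open>e_2n\<close> along any curve in the hypersurface with velocity \<open>v\<close>.
  At an end point of \<open>I\<close> there is no such curve for the vectors pointing out of the hypersurface;
  vectors in \<open>xi'\<close> are always covered, being tangent to the orbits of the unitary group.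
\<close>

definition shape_operator :: "real set \<Rightarrow> (real \<Rightarrow> real) \<Rightarrow> (real \<Rightarrow> real) \<Rightarrow> real \<Rightarrow>
    complex ^ 'n::finite \<Rightarrow> 'n heis \<Rightarrow> 'n heis" where
  "shape_operator I x t s \<omega> v =
     (THE w. \<forall>c. surface_curve I x t s \<omega> c v \<longrightarrow>
        w = - cov_deriv (\<lambda>u. rot_param x t (c u)) (\<lambda>u. e_2n I x t (fst (c u)) (snd (c u)))
            + alpha TYPE('n) I x t s *\<^sub>R J' I x t s \<omega> v)"

definition curv_k :: "'n::finite itself \<Rightarrow> real set \<Rightarrow> (real \<Rightarrow> real) \<Rightarrow> (real \<Rightarrow> real) \<Rightarrow> real \<Rightarrow> real" where
  "curv_k _ I x t s =
     (if CARD('n) = 1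
      then - deriv_in I t s / (x s * sqrt ((x s * deriv_in I x s)\<^sup>2 + (deriv_in I t s)\<^sup>2))
      else (THE \<kappa>. \<forall>\<omega> :: complex ^ 'n \<in> sphere 0 1. \<forall>v\<in>xi' I x t s \<omega>.
              shape_operator I x t s \<omega> v = \<kappa> *\<^sub>R v))"

definition has_invariants :: "real set \<Rightarrow> (real \<Rightarrow> real) \<Rightarrow> (real \<Rightarrow> real) \<Rightarrow>
    (real \<Rightarrow> real) \<Rightarrow> (real \<Rightarrow> real) \<Rightarrow> 'n::finite heis set \<Rightarrow> bool" where
  "has_invariants I a k x t S \<longleftrightarrow>
     rot_hypersurface I x t S \<and> horizontal_arclength TYPE('n) I x t \<and>
     (\<forall>s\<in>I. alpha TYPE('n) I x t s = a s \<and> curv_k TYPE('n) I x t s = k s)"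

end

theory Submission
  imports Defs
begin

text \<open>
  The existence and uniqueness statements reduce to an explicit computation of the invariants. At
  the point \<open>(x \<omega>, t)\<close> with \<open>|\<omega>| = 1\<close> every tangent vector is a multiple of \<open>(x' \<omega>, t')\<close> plus a vector
  \<open>(\<eta>, 0)\<close> with \<open>\<eta>\<close> real-orthogonal to \<open>\<omega>\<close>. Requiring the contact form to vanish fixes the component
  of \<open>\<eta>\<close> along \<open>\<i>\<omega>\<close>, so the horizontal part consists of the multiples of \<open>(x' - \<i> t'/x) \<omega>\<close> and of the
  vectors complex-orthogonal to \<open>\<omega>\<close>. The latter form \<open>xi'\<close>, and \<open>e_n\<close> is \<open>(x' - \<i> t'/x) \<omega>\<close>
  divided by the horizontal speed \<open>L\<close>, where \<open>L\<^sup>2 = x'\<^sup>2 + (t'/x)\<^sup>2\<close>. From this,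
  \<open>\<alpha> = x' / (x L)\<close> (lemma \<open>alpha_eq\<close>), and since moving along \<open>xi'\<close> only rotates \<open>\<omega>\<close>, differentiating
  \<open>e_2n\<close> gives \<open>k = - t' / (x\<^sup>2 L)\<close> (lemmas \<open>shape_operator_xi'\<close> and \<open>curv_k_eq\<close>).

  So a hypersurface has the prescribed invariants, with horizontal arc-length as parameter,
  exactly if \<open>x' = \<alpha> x\<close>, \<open>t' = - k x\<^sup>2\<close> and \<open>L = 1\<close> (lemma \<open>has_invariants_iff\<close>). The given pair solves
  this system. For uniqueness, the first two equations turn \<open>L = 1\<close> into
  \<open>x\<^sup>2 (\<alpha>\<^sup>2 + k\<^sup>2) = 1\<close>, which determines \<open>x > 0\<close> pointwise and excludes even a rescaling of \<open>x\<close>; then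
  \<open>t'\<close> is determined, and \<open>t\<close> is determined up to a constant. Adding a constant to \<open>t\<close> is a left
  translation by a central element, hence a rigid motion.

  Analysis enters in two places: \<open>x\<close> inherits smoothness from \<open>\<alpha>\<close> through \<open>x' = \<alpha> x\<close>, and the angle
  of the horizontal curve must exist on the whole interval, which here means that the
  continuous function \<open>k\<close> has an antiderivative there.
\<close>

section \<open>Calculus on an interval\<close>

lemma within_interval_nontrivial:
  fixes I :: "real set"
  assumes "is_interval I" "interior I \<noteq> {}" "s \<in> I"
  shows "at s within I \<noteq> bot"
proof -
  have "I \<noteq> {a}" for a using assms(2) by auto
  then have "s islimpt I"
    using connected_imp_perfect assms is_interval_connected_1 by metis
  then show ?thesis by (simp add: trivial_limit_within)
qed

lemma deriv_in_eq:
  assumes "is_interval I" "interior I \<noteq> {}" "s \<in> I"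
    and "(f has_vector_derivative f') (at s within I)"
  shows "deriv_in I f s = f'"
  using assms vector_derivative_unique_within vector_derivative_works within_interval_nontrivial
  by (metis differentiableI_vector)

lemma deriv_in_eq_real:
  assumes "is_interval I" "interior I \<noteq> {}" "s \<in> I"
    and "(f has_real_derivative f') (at s within I)"
  shows "deriv_in I f s = f'"
  using assms deriv_in_eq has_real_derivative_iff_has_vector_derivative by blast

lemma has_real_derivative_transform:
  fixes f g :: "real \<Rightarrow> real"
  assumes "(f has_real_derivative d) (at s within I)" "s \<in> I" "\<And>u. u \<in> I \<Longrightarrow> g u = f u"
  shows "(g has_real_derivative d) (at s within I)"
  using assms has_field_derivative_transform_within[where d=1] by (metis zero_less_one)

text \<open>
  The interval need not be closed, so integrals are taken from an arbitrary base point in \<open>I\<close>, with a sign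
  on its left. Near a given \<open>s\<close> this agrees up to a constant with an integral over a
  compact subinterval that is a neighbourhood of \<open>s\<close> in \<open>I\<close>.
\<close>

lemma antiderivative_on_interval:
  fixes g :: "real \<Rightarrow> real"
  assumes I: "is_interval I" and g: "continuous_on I g"
  obtains G where "\<And>s. s \<in> I \<Longrightarrow> (G has_real_derivative g s) (at s within I)"
proof (cases "I = {}")
  case False
  then obtain s0 where s0: "s0 \<in> I" by auto
  define G where "G s = (if s0 \<le> s then integral {s0..s} g else - integral {s..s0} g)" for s
  have "(G has_real_derivative g s) (at s within I)" if s: "s \<in> I" for s
  proof -
    \<comment> \<open>\<open>l\<close> and \<open>r\<close> equal \<open>s\<close> only where \<open>s\<close> is an end point of \<open>I\<close>.\<close>
    obtain l where l: "l \<in> I" "l \<le> s" "l < s \<or> (\<forall>u\<in>I. s \<le> u)"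
    proof (cases "\<exists>u\<in>I. u < s")
      case True
      then show ?thesis using that by force
    next
      case False
      then show ?thesis using that[of s] s by (auto simp: not_less)
    qed
    obtain r where r: "r \<in> I" "s \<le> r" "s < r \<or> (\<forall>u\<in>I. u \<le> s)"
    proof (cases "\<exists>u\<in>I. s < u")
      case True
      then show ?thesis using that by force
    next
      case False
      then show ?thesis using that[of s] s by (auto simp: not_less)
    qed
    define a b where "a = min l s0" and "b = max r s0"
    have ab: "a \<in> I" "b \<in> I" "a \<le> s0" "s0 \<le> b" "a \<le> s" "s \<le> b"
      using l r s0 by (auto simp: a_def b_def min_def max_def)
    have sub: "{a..b} \<subseteq> I" using mem_is_interval_1_I[OF I ab(1,2)] by auto
    have cont: "continuous_on {a..b} g" using g sub by (rule continuous_on_subset)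
    have G: "G u = integral {a..u} g - integral {a..s0} g" if "u \<in> {a..b}" for u
    proof (cases "s0 \<le> u")
      case True
      have "integral {a..s0} g + integral {s0..u} g = integral {a..u} g"
        by (rule Henstock_Kurzweil_Integration.integral_combine)
          (use True ab that in \<open>auto intro!: integrable_continuous_interval continuous_on_subset[OF cont]\<close>)
      then show ?thesis using True by (simp add: G_def)
    next
      case False
      have "integral {a..u} g + integral {u..s0} g = integral {a..s0} g"
        by (rule Henstock_Kurzweil_Integration.integral_combine)
          (use False ab that in \<open>auto intro!: integrable_continuous_interval continuous_on_subset[OF cont]\<close>)
      then show ?thesis using False by (simp add: G_def)
    qed
    have "((\<lambda>u. integral {a..u} g - integral {a..s0} g) has_real_derivative g s)
        (at s within {a..b})"
      using integral_has_real_derivative[OF cont, of s] ab by (auto intro!: derivative_eq_intros)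
    then have "(G has_real_derivative g s) (at s within {a..b})"
      by (rule has_real_derivative_transform) (use G ab in auto)
    moreover have "at s within {a..b} = at s within I"
    proof (rule at_within_nhd)
      let ?S = "{(if l < s then l else s - 1) <..< (if s < r then r else s + 1)}"
      show "s \<in> ?S" "open ?S" by auto
      show "{a..b} \<inter> ?S - {s} = I \<inter> ?S - {s}"
      proof (intro equalityI subsetI)
        fix u assume u: "u \<in> I \<inter> ?S - {s}"
        then have "(if l < s then l < u else s \<le> u)" "(if s < r then u < r else u \<le> s)"
          using l(3) r(3) by (auto split: if_splits)
        then have "a \<le> u" "u \<le> b" using l(2) r(2) by (auto simp: a_def b_def split: if_splits)
        then show "u \<in> {a..b} \<inter> ?S - {s}" using u by auto
      qed (use sub in auto)
    qed
    ultimately show ?thesis by simp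
  qed
  then show ?thesis using that by blast
qed (use that in auto)

text \<open>
  Smoothness on \<open>I\<close> supplies all derivatives at once. Counting derivatives instead makes closure
  under products, and the bootstrapping of regularity below, plain inductions.
\<close>

fun differentiable_times :: "nat \<Rightarrow> real set \<Rightarrow> (real \<Rightarrow> real) \<Rightarrow> bool" where
  "differentiable_times 0 I f = True"
| "differentiable_times (Suc m) I f =
     (\<exists>f'. (\<forall>s\<in>I. (f has_real_derivative f' s) (at s within I)) \<and> differentiable_times m I f')"

lemma differentiable_times_pred:
  "differentiable_times (Suc m) I f \<Longrightarrow> differentiable_times m I f"
  by (induction m arbitrary: f) fastforce+

lemma differentiable_times_cong:
  "differentiable_times m I f \<Longrightarrow> (\<And>s. s \<in> I \<Longrightarrow> g s = f s) \<Longrightarrow> differentiable_times m I g"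
  by (cases m) (auto intro: has_real_derivative_transform)

lemma differentiable_times_add:
  "differentiable_times m I f \<Longrightarrow> differentiable_times m I g \<Longrightarrow>
   differentiable_times m I (\<lambda>s. f s + g s)"
proof (induction m arbitrary: f g)
  case (Suc m)
  then obtain f' g' where "\<forall>s\<in>I. (f has_real_derivative f' s) (at s within I)"
      "\<forall>s\<in>I. (g has_real_derivative g' s) (at s within I)"
      "differentiable_times m I f'" "differentiable_times m I g'" by auto
  then show ?case using Suc.IH[of f' g']
    by (auto intro!: exI[of _ "\<lambda>s. f' s + g' s"] DERIV_add)
qed simp

lemma differentiable_times_mult:
  "differentiable_times m I f \<Longrightarrow> differentiable_times m I g \<Longrightarrow>
   differentiable_times m I (\<lambda>s. f s * g s)"
proof (induction m arbitrary: f g)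
  case (Suc m)
  then obtain f' g' where d: "\<forall>s\<in>I. (f has_real_derivative f' s) (at s within I)"
      "\<forall>s\<in>I. (g has_real_derivative g' s) (at s within I)"
      "differentiable_times m I f'" "differentiable_times m I g'" by auto
  have "differentiable_times m I (\<lambda>s. f' s * g s + g' s * f s)"
    using d Suc differentiable_times_pred by (intro differentiable_times_add Suc.IH) auto
  then show ?case using d
    by (auto intro!: exI[of _ "\<lambda>s. f' s * g s + g' s * f s"] DERIV_mult)
qed simp

lemma smooth_imp_differentiable_times:
  assumes "smooth_on_interval I f" shows "differentiable_times m I f"
proof -
  obtain D where D: "D 0 = f" "\<And>m s. s \<in> I \<Longrightarrow> (D m has_real_derivative D (Suc m) s) (at s within I)"
    using assms unfolding smooth_on_interval_def by blast
  have "differentiable_times m I (D k)" for k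
    by (induction m arbitrary: k) (use D in auto)
  then show ?thesis using D(1) by metis
qed

text \<open>
  Derivatives on \<open>I\<close> are unique, so the remaining differentiability is a property of any chosen
  derivative, not just of the witness in the definition.
\<close>

lemma differentiable_times_derivative:
  assumes I: "is_interval I" "interior I \<noteq> {}"
    and f: "differentiable_times (Suc m) I f"
    and d: "\<And>s. s \<in> I \<Longrightarrow> (f has_real_derivative f' s) (at s within I)"
  shows "differentiable_times m I f'"
proof -
  obtain h where h: "\<forall>s\<in>I. (f has_real_derivative h s) (at s within I)" "differentiable_times m I h"
    using f by auto
  have "f' s = h s" if "s \<in> I" for s
    using deriv_in_eq[OF I that] h d that by (metis has_real_derivative_iff_has_vector_derivative)
  then show ?thesis using h differentiable_times_cong by blast
qed

lemma smooth_if_differentiable_times: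
  assumes I: "is_interval I" "interior I \<noteq> {}" and f: "\<And>m. differentiable_times m I f"
  shows "smooth_on_interval I f"
proof -
  have d: "(h has_real_derivative deriv_in I h s) (at s within I)"
    if "differentiable_times 1 I h" "s \<in> I" for h s
  proof -
    obtain h' where "(h has_vector_derivative h') (at s within I)"
      using \<open>differentiable_times 1 I h\<close> \<open>s \<in> I\<close>
      by (auto simp: has_real_derivative_iff_has_vector_derivative)
    with deriv_in_eq[OF I \<open>s \<in> I\<close> this] show ?thesis
      by (simp add: has_real_derivative_iff_has_vector_derivative)
  qed
  define D where "D m = (deriv_in I ^^ m) f" for m
  have all: "differentiable_times k I (D m)" for k m
  proof (induction m arbitrary: k)
    case (Suc m)
    then show ?case using differentiable_times_derivative[OF I Suc.IH[of "Suc k"]] d[OF Suc.IH[of 1]]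
      by (simp add: D_def)
  qed (simp add: D_def f)
  have "\<forall>m. \<forall>s\<in>I. (D m has_real_derivative D (Suc m) s) (at s within I)"
    using d[OF all] by (simp add: D_def)
  moreover have "D 0 = f" by (simp add: D_def)
  ultimately show ?thesis unfolding smooth_on_interval_def by blast
qed

text \<open>
  Bootstrapping: if \<open>x\<close> is \<open>m\<close> times differentiable, so is \<open>a x = x'\<close>, and \<open>x\<close> gains a derivative.
\<close>

lemma smooth_solution_linear_ode:
  assumes I: "is_interval I" "interior I \<noteq> {}" and a: "smooth_on_interval I a"
    and x: "\<And>s. s \<in> I \<Longrightarrow> (x has_real_derivative a s * x s) (at s within I)"
  shows "smooth_on_interval I x"
proof (rule smooth_if_differentiable_times[OF I])
  show "differentiable_times m I x" for m
  proof (induction m)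
    case (Suc m)
    then have "differentiable_times m I (\<lambda>s. a s * x s)"
      by (intro differentiable_times_mult smooth_imp_differentiable_times[OF a])
    then show ?case using x by (auto intro!: exI[of _ "\<lambda>s. a s * x s"])
  qed simp
qed

lemma smooth_on_interval_mult:
  assumes "is_interval I" "interior I \<noteq> {}" "smooth_on_interval I f" "smooth_on_interval I g"
  shows "smooth_on_interval I (\<lambda>s. f s * g s)"
  by (rule smooth_if_differentiable_times[OF assms(1,2)], rule differentiable_times_mult)
    (rule assms(3,4)[THEN smooth_imp_differentiable_times])+

lemma smooth_on_interval_const: "smooth_on_interval I (\<lambda>_. c)"
  unfolding smooth_on_interval_def
  by (rule exI[of _ "\<lambda>m _. if m = 0 then c else 0"]) auto

lemma smooth_on_interval_antiderivative:
  assumes I: "is_interval I" "interior I \<noteq> {}" and f: "smooth_on_interval I f"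
    and d: "\<And>s. s \<in> I \<Longrightarrow> (h has_real_derivative f s) (at s within I)"
  shows "smooth_on_interval I h"
proof (rule smooth_if_differentiable_times[OF I])
  fix m
  have "differentiable_times (Suc m) I h"
    using d smooth_imp_differentiable_times[OF f] by (auto intro!: exI[of _ f])
  then show "differentiable_times m I h" by (rule differentiable_times_pred)
qed

lemma smooth_imp_continuous_on:
  "smooth_on_interval I f \<Longrightarrow> continuous_on I f"
  unfolding smooth_on_interval_def by (metis DERIV_continuous continuous_on_eq_continuous_within)

section \<open>The Heisenberg structure in terms of the real inner product\<close>

text \<open>
  With multiplication by \<open>\<i>\<close> written as a real linear isometry, the contact form, the Levi metric and
  \<open>J\<close> become inner products in real \<open>2n\<close>-space, where \<open>\<omega>\<close> and \<open>\<i>\<omega>\<close> are orthonormal for every unit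
  vector \<open>\<omega>\<close>. All the geometry below takes place in this form.
\<close>

abbreviation imul :: "complex ^ 'n::finite \<Rightarrow> complex ^ 'n" where
  "imul v \<equiv> \<i> *s v"

lemma inner_imul_imul: "imul v \<bullet> imul w = v \<bullet> w"
  by (simp add: inner_vec_def inner_complex_def add.commute)

lemma inner_imul_left: "imul v \<bullet> w = - (v \<bullet> imul w)"
  by (simp add: inner_vec_def inner_complex_def sum_negf[symmetric] algebra_simps)

lemma inner_imul_self [simp]: "imul v \<bullet> v = 0" "v \<bullet> imul v = 0"
  by (simp_all add: inner_vec_def inner_complex_def)

lemma imul_imul [simp]: "imul (imul v) = - v"
  by (simp add: vec_eq_iff)

lemma imul_add: "imul (v + w) = imul v + imul w"
  and imul_diff: "imul (v - w) = imul v - imul w"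
  and imul_scaleR: "imul (r *\<^sub>R v) = r *\<^sub>R imul v"
  and imul_minus: "imul (- v) = - imul v"
  by (simp_all add: vec_eq_iff algebra_simps)

lemma bounded_linear_imul: "bounded_linear (imul :: complex ^ 'n::finite \<Rightarrow> _)"
  by (rule linear_linear[THEN iffD2], rule linearI) (simp_all add: imul_add imul_scaleR)

lemma scale_complex_eq: "a *s v = Re a *\<^sub>R v + Im a *\<^sub>R imul v" for v :: "complex ^ 'n::finite"
  by (simp add: vec_eq_iff complex_eq_iff)

lemma norm_cis_scale: "norm (cis a *s \<omega>) = norm \<omega>" for \<omega> :: "complex ^ 'n::finite"
proof -
  have "(cis a *s \<omega>) \<bullet> (cis a *s \<omega>) = (cos a * cos a + sin a * sin a) * (\<omega> \<bullet> \<omega>)"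
    unfolding scale_complex_eq[of "cis a"] cis.sel
    by (simp only: inner_add_left inner_add_right inner_imul_imul inner_imul_self
        inner_scaleR_left inner_scaleR_right) (simp only: algebra_simps mult_zero_right)
  also have "\<dots> = \<omega> \<bullet> \<omega>" by simp
  finally have "(cis a *s \<omega>) \<bullet> (cis a *s \<omega>) = \<omega> \<bullet> \<omega>" .
  then show ?thesis by (simp add: norm_eq_sqrt_inner)
qed

lemma norm_axis_one: "norm (axis k (1::complex) :: complex ^ 'n::finite) = 1"
  by (simp add: norm_eq_sqrt_inner inner_axis_axis)

lemma levi_metric_eq: "levi_metric p v w = fst v \<bullet> fst w"
  by (simp add: levi_metric_def inner_vec_def inner_complex_def)

lemma contact_form_eq: "contact_form p v = snd v + imul (fst p) \<bullet> fst v"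
  by (simp add: contact_form_def inner_vec_def inner_complex_def)

lemma heis_J_eq: "heis_J p v = (imul (fst v), - (fst p \<bullet> fst v))"
proof -
  have "heis_J p v = from_frame p (imul (fst v), 0)"
    by (simp add: heis_J_def from_frame_def)
  then show ?thesis
    by (simp add: from_frame_eq contact_form_eq inner_imul_imul)
qed

section \<open>Unitary invariance\<close>

definition adjoint_matrix :: "complex ^ 'n::finite ^ 'n \<Rightarrow> complex ^ 'n ^ 'n" where
  "adjoint_matrix A = (\<chi> i j. cnj (A $ j $ i))"

lemma inner_adjoint_matrix: "(A *v z) \<bullet> w = z \<bullet> (adjoint_matrix A *v w)"
proof -
  have 1: "Re (a * b) * Re c + Im (a * b) * Im c = Re b * Re (cnj a * c) + Im b * Im (cnj a * c)"
    for a b c by (simp add: algebra_simps)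
  have "(A *v z) \<bullet> w = (\<Sum>i\<in>UNIV. \<Sum>j\<in>UNIV. z $ j \<bullet> (cnj (A $ i $ j) * w $ i))"
    unfolding inner_vec_def matrix_vector_mult_def vec_lambda_beta inner_sum_left
    unfolding inner_complex_def 1 ..
  also have "\<dots> = (\<Sum>j\<in>UNIV. \<Sum>i\<in>UNIV. z $ j \<bullet> (cnj (A $ i $ j) * w $ i))"
    by (rule sum.swap)
  also have "\<dots> = z \<bullet> (adjoint_matrix A *v w)"
    by (simp add: inner_vec_def matrix_vector_mult_def inner_sum_right adjoint_matrix_def)
  finally show ?thesis .
qed

lemma norm_preserved_if_adjoint_left_inverse:
  assumes "adjoint_matrix A ** A = mat 1" shows "norm (A *v z) = norm z"
  by (simp add: norm_eq_sqrt_inner inner_adjoint_matrix matrix_vector_mul_assoc assms)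

text \<open>
  Surjectivity of the induced map on the set uses that the adjoint also preserves norms.
\<close>

lemma U_invariant_radial: "U_invariant {p :: 'n::finite heis. P (norm (fst p)) (snd p)}"
  unfolding U_invariant_def
proof (intro allI impI)
  fix A :: "complex ^ 'n ^ 'n"
  assume "unitary A"
  then have u: "A ** adjoint_matrix A = mat 1" "adjoint_matrix A ** A = mat 1"
    by (simp_all add: unitary_def adjoint_matrix_def)
  have inv: "adjoint_matrix (adjoint_matrix A) = A"
    by (simp add: adjoint_matrix_def vec_eq_iff)
  have n: "norm (A *v z) = norm z" "norm (adjoint_matrix A *v z) = norm z" for z
    using norm_preserved_if_adjoint_left_inverse[of A z]
      norm_preserved_if_adjoint_left_inverse[of "adjoint_matrix A" z] u by (simp_all add: inv)
  show "unitary_map A ` {p :: 'n heis. P (norm (fst p)) (snd p)} = {p. P (norm (fst p)) (snd p)}"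
  proof (intro equalityI subsetI)
    fix p :: "'n heis" assume "p \<in> {p. P (norm (fst p)) (snd p)}"
    then have "p = unitary_map A (unitary_map (adjoint_matrix A) p)"
        "unitary_map (adjoint_matrix A) p \<in> {p. P (norm (fst p)) (snd p)}"
      using u n by (simp_all add: unitary_map_def matrix_vector_mul_assoc)
    then show "p \<in> unitary_map A ` {p :: 'n heis. P (norm (fst p)) (snd p)}" by blast
  qed (use n in \<open>auto simp: unitary_map_def\<close>)
qed

section \<open>One-sided velocities\<close>

text \<open>
  Replacing the filter by a set on which the property holds everywhere allows the chain rule for
  functions that are differentiable only within \<open>I\<close>, such as \<open>x\<close> and \<open>t\<close> at an end point.
\<close>

lemma at_right_0_within:
  assumes "eventually P (at_right (0::real))" and "P 0"
  obtains d where "d > 0" "at_right 0 = at 0 within {0..<d}" "\<And>u. u \<in> {0..<d} \<Longrightarrow> P u"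
proof -
  obtain d where d: "d > 0" "\<And>u. 0 < u \<Longrightarrow> u < d \<Longrightarrow> P u"
    using assms(1) by (auto simp: eventually_at_right_field)
  have "at 0 within {0<..} = at 0 within {0..<d}"
    by (rule at_within_nhd[of _ "{-1<..<d}"]) (use d in auto)
  then show ?thesis using d assms(2) by (intro that[of d]) (auto simp: le_less)
qed

lemma derivative_in_sphere_orthogonal:
  fixes \<omega> :: "real \<Rightarrow> 'a::real_inner"
  assumes d: "(\<omega> has_vector_derivative \<mu>) (at_right 0)"
    and ev: "\<forall>\<^sub>F u in at_right 0. norm (\<omega> u) = 1" and 0: "norm (\<omega> 0) = 1"
  shows "\<omega> 0 \<bullet> \<mu> = 0"
proof -
  have "((\<lambda>u. \<omega> u \<bullet> \<omega> u) has_vector_derivative \<omega> 0 \<bullet> \<mu> + \<mu> \<bullet> \<omega> 0) (at_right 0)"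
    by (rule bounded_bilinear.has_vector_derivative[OF bounded_bilinear_inner d d])
  moreover have "((\<lambda>u. \<omega> u \<bullet> \<omega> u) has_vector_derivative 0) (at_right 0)"
  proof -
    obtain d where d: "d > 0" "at_right 0 = at 0 within {0..<d}"
        "\<And>u. u \<in> {0..<d} \<Longrightarrow> norm (\<omega> u) = 1"
      using at_right_0_within[OF ev 0] by blast
    have "((\<lambda>u. 1::real) has_vector_derivative 0) (at 0 within {0..<d})" by simp
    then show ?thesis unfolding d(2)
      by (rule has_vector_derivative_transform[rotated 2]) (use d in \<open>auto simp: norm_eq_1\<close>)
  qed
  ultimately have "\<omega> 0 \<bullet> \<mu> + \<mu> \<bullet> \<omega> 0 = 0"
    by (rule vector_derivative_unique_within[rotated]) simp
  then show ?thesis by (simp add: inner_commute)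
qed

lemma chain_rule_at_right_0:
  fixes f :: "real \<Rightarrow> real"
  assumes f: "(f has_real_derivative f') (at s within I)"
    and c: "(\<sigma> has_vector_derivative \<sigma>') (at_right 0)" and 0: "\<sigma> 0 = s" "s \<in> I"
    and ev: "\<forall>\<^sub>F u in at_right 0. \<sigma> u \<in> I"
  shows "((\<lambda>u. f (\<sigma> u)) has_vector_derivative f' * \<sigma>') (at_right 0)"
proof -
  obtain d where d: "d > 0" "at_right 0 = at 0 within {0..<d}" "\<And>u. u \<in> {0..<d} \<Longrightarrow> \<sigma> u \<in> I"
    using at_right_0_within[OF ev] 0 by blast
  have "(f has_derivative (\<lambda>h. f' * h)) (at (\<sigma> 0) within \<sigma> ` {0..<d})"
    using f d(3) 0 unfolding has_field_derivative_def by (auto intro: has_derivative_subset)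
  from vector_derivative_diff_chain_within[OF c[unfolded d(2)] this]
  show ?thesis by (simp add: d(2) o_def)
qed

text \<open>
  Normalising the line \<open>\<omega> + u \<mu>\<close> keeps its initial velocity, because its norm
  \<open>sqrt (1 + u\<^sup>2 |\<mu>|\<^sup>2)\<close> is stationary at \<open>0\<close>.
\<close>

lemma unit_sphere_curve:
  fixes \<omega> \<mu> :: "'a::real_inner"
  assumes "norm \<omega> = 1" "\<omega> \<bullet> \<mu> = 0"
  obtains \<gamma> where "\<gamma> 0 = \<omega>" "\<And>u. norm (\<gamma> u) = 1" "(\<gamma> has_vector_derivative \<mu>) (at (0::real) within S)"
proof -
  define f where "f u = 1 / sqrt (1 + (u * norm \<mu>)\<^sup>2)" for u
  define \<gamma> where "\<gamma> u = f u *\<^sub>R (\<omega> + u *\<^sub>R \<mu>)" for u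
  have "norm (\<omega> + u *\<^sub>R \<mu>) = sqrt (1 + (u * norm \<mu>)\<^sup>2)" for u
    using assms by (simp add: norm_eq_sqrt_inner inner_add_left inner_add_right inner_commute
        power_mult_distrib power2_eq_square real_sqrt_eq_1_iff)
  moreover have "sqrt (1 + (u * norm \<mu>)\<^sup>2) > 0" for u
    by (simp add: add_pos_nonneg)
  ultimately have n: "norm (\<gamma> u) = 1" for u
    by (simp add: \<gamma>_def f_def less_imp_neq[symmetric])
  have "(f has_real_derivative 0) (at 0 within S)"
    unfolding f_def by (auto intro!: derivative_eq_intros)
  moreover have "((\<lambda>u. \<omega> + u *\<^sub>R \<mu>) has_vector_derivative \<mu>) (at 0 within S)"
    by (auto intro!: derivative_eq_intros simp: has_vector_derivative_def)
  ultimately have "(\<gamma> has_vector_derivative \<mu>) (at 0 within S)"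
    unfolding \<gamma>_def using has_vector_derivative_scaleR[of f 0 0 S] by (fastforce simp: f_def)
  moreover have "\<gamma> 0 = \<omega>" by (simp add: \<gamma>_def f_def)
  ultimately show ?thesis using n that by blast
qed

lemma has_vector_derivative_pair:
  assumes "(f has_vector_derivative f') (at a within S)" "(g has_vector_derivative g') (at a within S)"
  shows "((\<lambda>u. (f u, g u)) has_vector_derivative (f', g')) (at a within S)"
  using assms unfolding has_vector_derivative_def scaleR_Pair by (rule has_derivative_Pair)

section \<open>The tangent spaces of a rotationally symmetric hypersurface\<close>

text \<open>
  Second derivatives occur because the shape operator differentiates \<open>e_2n\<close>, which involves the
  first derivatives of the profile. The horizontal angle is required to exist because it fixes the
  orientation of \<open>e_n\<close>.
\<close>

locale rotational_profile =
  fixes I :: "real set" and x t dx dt ddx ddt :: "real \<Rightarrow> real"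
  assumes interval: "is_interval I" "interior I \<noteq> {}"
    and pos: "s \<in> I \<Longrightarrow> x s > 0"
    and dx: "s \<in> I \<Longrightarrow> (x has_real_derivative dx s) (at s within I)"
    and dt: "s \<in> I \<Longrightarrow> (t has_real_derivative dt s) (at s within I)"
    and ddx: "s \<in> I \<Longrightarrow> (dx has_real_derivative ddx s) (at s within I)"
    and ddt: "s \<in> I \<Longrightarrow> (dt has_real_derivative ddt s) (at s within I)"
    and regular: "s \<in> I \<Longrightarrow> (dx s, dt s) \<noteq> (0, 0)"
    and angle: "\<exists>\<theta>. horizontal_angle I x t \<theta>"
begin

lemma deriv_in_dx: "s \<in> I \<Longrightarrow> deriv_in I x s = dx s"
  and deriv_in_dt: "s \<in> I \<Longrightarrow> deriv_in I t s = dt s"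
  by (blast intro: deriv_in_eq_real[OF interval] dx dt)+

definition speed :: "real \<Rightarrow> real" where
  "speed s = sqrt ((dx s)\<^sup>2 + (dt s / x s)\<^sup>2)"

lemma speed_pos: "s \<in> I \<Longrightarrow> speed s > 0"
  using regular[of s] pos[of s] by (auto simp: speed_def sum_power2_gt_zero_iff)

lemma rot_param_velocity:
  fixes \<omega> \<mu> :: "complex ^ 'n::finite"
  assumes s: "s \<in> I" and c: "(c has_vector_derivative (\<sigma>, \<mu>)) (at_right 0)" and 0: "c 0 = (s, \<omega>)"
    and ev: "\<forall>\<^sub>F u in at_right 0. fst (c u) \<in> I"
  shows "((\<lambda>u. rot_param x t (c u)) has_vector_derivative
           ((dx s * \<sigma>) *\<^sub>R \<omega> + x s *\<^sub>R \<mu>, dt s * \<sigma>)) (at_right 0)"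
proof -
  have f: "((\<lambda>u. fst (c u)) has_vector_derivative \<sigma>) (at_right 0)"
    and g: "((\<lambda>u. snd (c u)) has_vector_derivative \<mu>) (at_right 0)"
    using bounded_linear.has_vector_derivative[OF bounded_linear_fst c]
      bounded_linear.has_vector_derivative[OF bounded_linear_snd c] by simp_all
  have x: "((\<lambda>u. x (fst (c u))) has_vector_derivative dx s * \<sigma>) (at_right 0)"
    and t: "((\<lambda>u. t (fst (c u))) has_vector_derivative dt s * \<sigma>) (at_right 0)"
    using chain_rule_at_right_0[OF dx[OF s] f] chain_rule_at_right_0[OF dt[OF s] f] s 0 ev by simp_all
  have "((\<lambda>u. x (fst (c u)) *\<^sub>R snd (c u)) has_vector_derivative
      (dx s * \<sigma>) *\<^sub>R \<omega> + x s *\<^sub>R \<mu>) (at_right 0)"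
    using bounded_bilinear.has_vector_derivative[OF bounded_bilinear_scaleR x g] 0
    by (simp add: add.commute)
  from has_vector_derivative_pair[OF this t] show ?thesis by (simp add: rot_param_def)
qed

lemma surface_curve_velocity:
  fixes \<omega> :: "complex ^ 'n::finite"
  assumes s: "s \<in> I" and \<omega>: "norm \<omega> = 1" and c: "surface_curve I x t s \<omega> c v"
  obtains \<sigma> \<mu> where "(c has_vector_derivative (\<sigma>, \<mu>)) (at_right 0)" "\<omega> \<bullet> \<mu> = 0"
    "v = ((dx s * \<sigma>) *\<^sub>R \<omega> + x s *\<^sub>R \<mu>, dt s * \<sigma>)"
proof -
  have c0: "c 0 = (s, \<omega>)" and ev: "\<forall>\<^sub>F u in at_right 0. c u \<in> I \<times> sphere 0 1"
    and d: "c differentiable (at_right 0)"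
    and v: "((\<lambda>u. rot_param x t (c u)) has_vector_derivative v) (at_right 0)"
    using c by (auto simp: surface_curve_def)
  obtain \<sigma> \<mu> where c': "(c has_vector_derivative (\<sigma>, \<mu>)) (at_right 0)"
    using d by (metis prod.collapse vector_derivative_works)
  have evI: "\<forall>\<^sub>F u in at_right 0. fst (c u) \<in> I"
    and evS: "\<forall>\<^sub>F u in at_right 0. norm (snd (c u)) = 1"
    by (use ev in \<open>auto elim!: eventually_mono\<close>)
  have "\<omega> \<bullet> \<mu> = 0"
    using derivative_in_sphere_orthogonal[OF _ evS, of \<mu>]
      bounded_linear.has_vector_derivative[OF bounded_linear_snd c'] c0 \<omega> by simp
  moreover have "v = ((dx s * \<sigma>) *\<^sub>R \<omega> + x s *\<^sub>R \<mu>, dt s * \<sigma>)"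
    by (rule vector_derivative_unique_within[OF _ v rot_param_velocity[OF s c' c0 evI]]) simp
  ultimately show ?thesis using c' that by blast
qed

lemma orbit_surface_curve:
  fixes \<omega> :: "complex ^ 'n::finite"
  assumes s: "s \<in> I" and \<omega>: "norm \<omega> = 1" and \<eta>: "\<omega> \<bullet> \<eta> = 0"
  shows "\<exists>c. surface_curve I x t s \<omega> c (\<eta>, 0)"
proof -
  have "\<omega> \<bullet> (\<eta> /\<^sub>R x s) = 0" using \<eta> by simp
  then obtain \<gamma> where \<gamma>: "\<gamma> 0 = \<omega>" "\<And>u. norm (\<gamma> u) = 1"
      "(\<gamma> has_vector_derivative \<eta> /\<^sub>R x s) (at_right (0::real))"
    using unit_sphere_curve[OF \<omega>] by blast
  let ?c = "\<lambda>u. (s, \<gamma> u)"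
  have d: "(?c has_vector_derivative (0, \<eta> /\<^sub>R x s)) (at_right 0)"
    by (intro has_vector_derivative_pair \<gamma>) simp
  have "((\<lambda>u. rot_param x t (?c u)) has_vector_derivative (\<eta>, 0)) (at_right 0)"
    using rot_param_velocity[OF s d, of \<omega>] s \<gamma>(1) pos[OF s] by simp
  then have "surface_curve I x t s \<omega> ?c (\<eta>, 0)"
    using d \<gamma> s differentiableI_vector by (auto simp: surface_curve_def)
  then show ?thesis by blast
qed

text \<open>
  At an end point of \<open>I\<close> the parameter can move only in one direction, so a curve in the direction of
  the profile exists only up to a nonzero factor, of either sign.
\<close>

lemma radial_surface_curve:
  fixes \<omega> :: "complex ^ 'n::finite"
  assumes s: "s \<in> I" and \<omega>: "norm \<omega> = 1"
  obtains e :: real where "e \<noteq> 0" "\<exists>c. surface_curve I x t s \<omega> c (e *\<^sub>R (dx s *\<^sub>R \<omega>, dt s))"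
proof -
  have "I \<noteq> {s}" using interval(2) by auto
  then obtain q where q: "q \<in> I" "q \<noteq> s" using s by blast
  \<comment> \<open>The parameter moves linearly from \<open>s\<close> towards \<open>q\<close>, within \<open>I\<close> by convexity.\<close>
  define e where "e = q - s"
  have e: "e \<noteq> 0" using q by (simp add: e_def)
  have "s + u * e \<in> I" if "0 < u" "u < 1" for u
  proof -
    have "(1 - u) *\<^sub>R s + u *\<^sub>R q \<in> I"
      using convexD_alt[of I s q u] is_interval_convex[OF interval(1)] s q that by simp
    then show ?thesis by (simp add: e_def algebra_simps)
  qed
  then have ev: "\<forall>\<^sub>F u in at_right 0. s + u * e \<in> I"
    by (auto simp: eventually_at_right_field intro!: exI[of _ 1])
  let ?c = "\<lambda>u. (s + u * e, \<omega>)"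
  have d: "(?c has_vector_derivative (e, 0)) (at_right 0)"
    by (intro has_vector_derivative_pair) (auto intro!: derivative_eq_intros)
  have "((\<lambda>u. rot_param x t (?c u)) has_vector_derivative e *\<^sub>R (dx s *\<^sub>R \<omega>, dt s)) (at_right 0)"
    using rot_param_velocity[OF s d, of \<omega>] ev by (simp add: mult.commute)
  then have "surface_curve I x t s \<omega> ?c (e *\<^sub>R (dx s *\<^sub>R \<omega>, dt s))"
    using d \<omega> ev differentiableI_vector by (auto simp: surface_curve_def)
  then show ?thesis using e that by blast
qed

text \<open>
  For a tangent vector \<open>(w, h)\<close> the pair \<open>(\<omega> \<bullet> w, h)\<close> has to be parallel to \<open>(x', t')\<close>,
  while the component of \<open>w\<close> orthogonal to \<open>\<omega>\<close> is free. Since \<open>(x', t')\<close> is nonzero, being parallel is the vanishing of a determinant.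
\<close>

lemma tangent_space_eq:
  fixes \<omega> :: "complex ^ 'n::finite"
  assumes s: "s \<in> I" and \<omega>: "norm \<omega> = 1"
  shows "tangent_space I x t s \<omega> = {v. (\<omega> \<bullet> fst v) * dt s = dx s * snd v}" (is "?T = ?R")
proof
  have \<omega>\<omega>: "\<omega> \<bullet> \<omega> = 1" using \<omega> by (simp add: norm_eq_1)
  have "subspace ?R"
    by (auto simp: subspace_def inner_add_right algebra_simps)
  moreover have "{v. \<exists>c. surface_curve I x t s \<omega> c v} \<subseteq> ?R"
    using surface_curve_velocity[OF s \<omega>] \<omega>\<omega> by (fastforce simp: inner_add_right)
  ultimately show "?T \<subseteq> ?R"
    unfolding tangent_space_def by (rule span_minimal[rotated])
  show "?R \<subseteq> ?T"
  proof
    fix v assume v: "v \<in> ?R"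
    obtain e where e: "e \<noteq> 0" "e *\<^sub>R (dx s *\<^sub>R \<omega>, dt s) \<in> ?T"
      using radial_surface_curve[OF s \<omega>] unfolding tangent_space_def
      by (metis (mono_tags, lifting) mem_Collect_eq span_base)
    have r: "(dx s *\<^sub>R \<omega>, dt s) \<in> ?T"
      using span_scale[OF e(2)[unfolded tangent_space_def], of "inverse e"] e(1)
      by (simp add: tangent_space_def mult.assoc[symmetric])
    define N where "N = (dx s)\<^sup>2 + (dt s)\<^sup>2"
    have N: "N \<noteq> 0" using regular[OF s] by (auto simp: N_def)
    \<comment> \<open>The factor by which \<open>(\<omega> \<bullet> fst v, snd v)\<close> is a multiple of \<open>(x', t')\<close>.\<close>
    define a where "a = ((\<omega> \<bullet> fst v) * dx s + snd v * dt s) / N"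
    have a: "\<omega> \<bullet> fst v = a * dx s" "snd v = a * dt s"
    proof -
      have "((\<omega> \<bullet> fst v) * dx s + snd v * dt s) * dx s = (\<omega> \<bullet> fst v) * N"
        "((\<omega> \<bullet> fst v) * dx s + snd v * dt s) * dt s = snd v * N"
        using v unfolding N_def by (simp_all, algebra+)
      then show "\<omega> \<bullet> fst v = a * dx s" "snd v = a * dt s"
        using N by (simp_all add: a_def field_simps)
    qed
    define \<eta> where "\<eta> = fst v - (a * dx s) *\<^sub>R \<omega>"
    have "\<omega> \<bullet> \<eta> = 0" using a \<omega>\<omega> by (simp add: \<eta>_def inner_diff_right)
    then have "(\<eta>, 0) \<in> ?T"
      using orbit_surface_curve[OF s \<omega>] by (auto simp: tangent_space_def intro!: span_base)
    then have "a *\<^sub>R (dx s *\<^sub>R \<omega>, dt s) + (\<eta>, 0) \<in> ?T"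
      using r unfolding tangent_space_def by (intro span_add span_scale)
    moreover have "a *\<^sub>R (dx s *\<^sub>R \<omega>, dt s) + (\<eta>, 0) = v"
      using a by (simp add: \<eta>_def prod_eq_iff)
    ultimately show "v \<in> ?T" by simp
  qed
qed

section \<open>The horizontal frame\<close>

text \<open>
  Write \<open>x' - \<i> t'/x = L e\<^sup>-\<^sup>i\<^sup>\<phi>\<close> with the horizontal speed \<open>L\<close>; these are the cosine and the sine of
  \<open>\<phi>\<close>, and \<open>e\<^sup>-\<^sup>i\<^sup>\<phi> \<omega>\<close> is the contact-plane direction of \<open>e_n\<close>.
\<close>

definition cos_slope :: "real \<Rightarrow> real" where "cos_slope s = dx s / speed s"
definition sin_slope :: "real \<Rightarrow> real" where "sin_slope s = dt s / (x s * speed s)"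

lemma slope_unit: "s \<in> I \<Longrightarrow> (cos_slope s)\<^sup>2 + (sin_slope s)\<^sup>2 = 1"
proof -
  assume s: "s \<in> I"
  have "(cos_slope s)\<^sup>2 + (sin_slope s)\<^sup>2 = ((dx s)\<^sup>2 + (dt s / x s)\<^sup>2) / (speed s)\<^sup>2"
    by (simp add: cos_slope_def sin_slope_def power_divide power_mult_distrib add_divide_distrib)
  also have "\<dots> = 1"
  proof -
    have "(speed s)\<^sup>2 = (dx s)\<^sup>2 + (dt s / x s)\<^sup>2" by (simp add: speed_def)
    then show ?thesis using speed_pos[OF s] by (metis div_self less_irrefl zero_eq_power2)
  qed
  finally show ?thesis .
qed

lemma dx_eq: "s \<in> I \<Longrightarrow> dx s = speed s * cos_slope s"
  and dt_eq: "s \<in> I \<Longrightarrow> dt s = speed s * (x s * sin_slope s)"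
  using speed_pos[of s] pos[of s] by (simp_all add: cos_slope_def sin_slope_def)

definition e_n_dir :: "real \<Rightarrow> complex ^ 'n::finite \<Rightarrow> complex ^ 'n" where
  "e_n_dir s \<omega> = cos_slope s *\<^sub>R \<omega> - sin_slope s *\<^sub>R imul \<omega>"

lemma imul_e_n_dir: "imul (e_n_dir s \<omega>) = cos_slope s *\<^sub>R imul \<omega> + sin_slope s *\<^sub>R \<omega>"
  by (simp add: e_n_dir_def imul_diff imul_scaleR)

lemma e_n_dir_unit: "s \<in> I \<Longrightarrow> norm \<omega> = 1 \<Longrightarrow> e_n_dir s \<omega> \<bullet> e_n_dir s \<omega> = 1"
  using slope_unit[of s]
  by (simp add: e_n_dir_def inner_diff_left inner_diff_right inner_imul_imul norm_eq_1 power2_eq_square)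

text \<open>
  \<open>e_n_dir s \<omega>\<close> is a unit complex multiple of \<open>\<omega>\<close>, so both span the same complex line.
\<close>

lemma orthogonal_e_n_dir_iff:
  assumes "s \<in> I"
  shows "e_n_dir s \<omega> \<bullet> w = 0 \<and> imul (e_n_dir s \<omega>) \<bullet> w = 0 \<longleftrightarrow> \<omega> \<bullet> w = 0 \<and> imul \<omega> \<bullet> w = 0"
proof
  assume h: "e_n_dir s \<omega> \<bullet> w = 0 \<and> imul (e_n_dir s \<omega>) \<bullet> w = 0"
  let ?a = "\<omega> \<bullet> w" and ?b = "imul \<omega> \<bullet> w" and ?c = "cos_slope s" and ?d = "sin_slope s"
  have "?c * ?a - ?d * ?b = 0" "?c * ?b + ?d * ?a = 0" "?c\<^sup>2 + ?d\<^sup>2 = 1"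
    using h slope_unit[OF assms] unfolding imul_e_n_dir
    by (simp_all add: e_n_dir_def inner_diff_left inner_add_left)
  then show "?a = 0 \<and> ?b = 0" by algebra
qed (simp add: imul_e_n_dir, simp add: e_n_dir_def inner_diff_left inner_add_left)

lemma rot_param_fst [simp]: "fst (rot_param x t (s, \<omega>)) = x s *\<^sub>R \<omega>"
  by (simp add: rot_param_def)

text \<open>
  Within the contact planes, a vector is determined by \<open>fst v\<close>; substituting its vertical component
  into the determinant of \<open>tangent_space_eq\<close> leaves \<open>x L\<close> times the inner product with
  \<open>\<i> e_n_dir s \<omega>\<close>. Thus the direction of \<open>e_2n\<close> is the horizontal normal of the hypersurface.
\<close>

lemma horizontal_tangent_eq:
  fixes \<omega> :: "complex ^ 'n::finite"
  assumes s: "s \<in> I" and \<omega>: "norm \<omega> = 1"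
  shows "horizontal_tangent I x t s \<omega> =
    {v. snd v = - (x s * (imul \<omega> \<bullet> fst v)) \<and> imul (e_n_dir s \<omega>) \<bullet> fst v = 0}"
proof -
  have "(\<omega> \<bullet> w) * dt s = dx s * - (x s * (imul \<omega> \<bullet> w)) \<longleftrightarrow> imul (e_n_dir s \<omega>) \<bullet> w = 0" for w
  proof -
    have "(\<omega> \<bullet> w) * dt s - dx s * - (x s * (imul \<omega> \<bullet> w)) =
        (speed s * x s) * (imul (e_n_dir s \<omega>) \<bullet> w)"
      unfolding dx_eq[OF s] dt_eq[OF s] imul_e_n_dir by (simp add: inner_add_left algebra_simps)
    then show ?thesis using speed_pos[OF s] pos[OF s]
      by (metis eq_iff_diff_eq_0 less_irrefl mult_eq_0_iff)
  qed
  moreover have "contact_form (rot_param x t (s, \<omega>)) v = 0 \<longleftrightarrow>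
      snd v = - (x s * (imul \<omega> \<bullet> fst v))" for v
    by (auto simp: contact_form_eq imul_scaleR)
  ultimately show ?thesis
    unfolding horizontal_tangent_def contact_plane_def tangent_space_eq[OF s \<omega>]
    by (auto simp del: minus_mult_left)
qed

text \<open>
  A horizontal tangent vector that is also \<open>J\<close> of one is orthogonal to the horizontal normal and to
  its image under \<open>\<i>\<close>, hence to the complex line through \<open>\<omega>\<close>. Conversely the complex-orthogonal
  complement of \<open>\<omega>\<close> is invariant under \<open>\<i>\<close>, and its vectors have no vertical component.
\<close>

lemma xi'_eq:
  fixes \<omega> :: "complex ^ 'n::finite"
  assumes s: "s \<in> I" and \<omega>: "norm \<omega> = 1"
  shows "xi' I x t s \<omega> = {v. snd v = 0 \<and> \<omega> \<bullet> fst v = 0 \<and> imul \<omega> \<bullet> fst v = 0}" (is "_ = ?R")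
proof (intro equalityI subsetI)
  fix v assume "v \<in> xi' I x t s \<omega>"
  then obtain v' where v: "v \<in> horizontal_tangent I x t s \<omega>"
    and v': "v' \<in> horizontal_tangent I x t s \<omega>" "v = heis_J (rot_param x t (s, \<omega>)) v'"
    by (auto simp: xi'_def)
  have "fst v = imul (fst v')" using v' by (simp add: heis_J_eq)
  then have "e_n_dir s \<omega> \<bullet> fst v = 0"
    using v'(1) inner_imul_left[of "e_n_dir s \<omega>" "fst v'"] by (simp add: horizontal_tangent_eq[OF s \<omega>])
  then show "v \<in> ?R"
    using v orthogonal_e_n_dir_iff[OF s, of \<omega> "fst v"] by (simp add: horizontal_tangent_eq[OF s \<omega>])
next
  fix v assume v: "v \<in> ?R"
  let ?v' = "(- imul (fst v), 0)"
  have o: "\<omega> \<bullet> fst v = 0" "imul \<omega> \<bullet> fst v = 0" "\<omega> \<bullet> imul (fst v) = 0"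
    using v inner_imul_left[of \<omega> "fst v"] by auto
  have "v \<in> horizontal_tangent I x t s \<omega>" "?v' \<in> horizontal_tangent I x t s \<omega>"
    using v o by (simp_all add: horizontal_tangent_eq[OF s \<omega>] imul_e_n_dir inner_add_left inner_imul_imul)
  moreover have "v = heis_J (rot_param x t (s, \<omega>)) ?v'"
    using v o by (simp add: heis_J_eq prod_eq_iff imul_minus)
  ultimately show "v \<in> xi' I x t s \<omega>" unfolding xi'_def by blast
qed

text \<open>
  With \<open>\<theta>' = - t'/x\<^sup>2\<close>, differentiating \<open>x e\<^sup>i\<^sup>\<theta> \<omega>\<close> gives \<open>(x' - \<i> t'/x) e\<^sup>i\<^sup>\<theta> \<omega>\<close>. The angle was chosen to
  make this velocity horizontal; its length is the horizontal speed.
\<close>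

lemma horizontal_curve_velocity:
  fixes \<omega> :: "complex ^ 'n::finite"
  assumes s: "s \<in> I" and \<theta>: "horizontal_angle I x t \<theta>"
  shows "deriv_in I (horizontal_curve x t \<theta> \<omega>) s =
    (speed s *\<^sub>R e_n_dir s (cis (\<theta> s) *s \<omega>), dt s)"
proof -
  have \<theta>': "(\<theta> has_real_derivative - dt s / (x s)\<^sup>2) (at s within I)"
    using \<theta> s by (simp add: horizontal_angle_def deriv_in_dt)
  have 1: "((\<lambda>u. x u * cos (\<theta> u)) has_real_derivative
      dx s * cos (\<theta> s) + dt s / x s * sin (\<theta> s)) (at s within I)"
    using pos[OF s]
    by (auto intro!: derivative_eq_intros dx[OF s] \<theta>' simp: power2_eq_square field_simps)
  have 2: "((\<lambda>u. x u * sin (\<theta> u)) has_real_derivative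
      dx s * sin (\<theta> s) - dt s / x s * cos (\<theta> s)) (at s within I)"
    using pos[OF s]
    by (auto intro!: derivative_eq_intros dx[OF s] \<theta>' simp: power2_eq_square field_simps)
  have 3: "speed s *\<^sub>R e_n_dir s (cis (\<theta> s) *s \<omega>) =
     (dx s * cos (\<theta> s) + dt s / x s * sin (\<theta> s)) *\<^sub>R \<omega> +
     (dx s * sin (\<theta> s) - dt s / x s * cos (\<theta> s)) *\<^sub>R imul \<omega>"
    unfolding dx_eq[OF s] dt_eq[OF s] using pos[OF s]
    by (simp add: e_n_dir_def scale_complex_eq[of "cis (\<theta> s)"] imul_add imul_scaleR algebra_simps)
  have "((\<lambda>u. (x u * cos (\<theta> u)) *\<^sub>R \<omega> + (x u * sin (\<theta> u)) *\<^sub>R imul \<omega>) has_vector_derivative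
      speed s *\<^sub>R e_n_dir s (cis (\<theta> s) *s \<omega>)) (at s within I)"
    unfolding 3 using has_vector_derivative_scaleR[OF 1, of "\<lambda>_. \<omega>" 0]
      has_vector_derivative_scaleR[OF 2, of "\<lambda>_. imul \<omega>" 0]
    by (intro has_vector_derivative_add) simp_all
  moreover have "(t has_vector_derivative dt s) (at s within I)"
    using dt[OF s] by (simp add: has_real_derivative_iff_has_vector_derivative)
  ultimately have "((\<lambda>u. ((x u * cos (\<theta> u)) *\<^sub>R \<omega> + (x u * sin (\<theta> u)) *\<^sub>R imul \<omega>, t u))
      has_vector_derivative (speed s *\<^sub>R e_n_dir s (cis (\<theta> s) *s \<omega>), dt s)) (at s within I)"
    by (rule has_vector_derivative_pair)
  moreover have "horizontal_curve x t \<theta> \<omega> =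
      (\<lambda>u. ((x u * cos (\<theta> u)) *\<^sub>R \<omega> + (x u * sin (\<theta> u)) *\<^sub>R imul \<omega>, t u))"
    by (simp add: fun_eq_iff horizontal_curve_def scale_complex_eq[of "cis _"] algebra_simps)
  ultimately show ?thesis using deriv_in_eq[OF interval s] by metis
qed

lemma horizontal_arclength_iff:
  "horizontal_arclength TYPE('n::finite) I x t \<longleftrightarrow> (\<forall>s\<in>I. speed s = 1)"
proof -
  have *: "(let v = deriv_in I (horizontal_curve x t \<theta> \<omega>) s
      in sqrt (levi_metric (horizontal_curve x t \<theta> \<omega> s) v v) = 1) \<longleftrightarrow> speed s = 1"
    if "horizontal_angle I x t \<theta>" "s \<in> I" "norm \<omega> = 1" for \<theta> s and \<omega> :: "complex ^ 'n"
    using that speed_pos[of s]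
    by (simp add: levi_metric_eq horizontal_curve_velocity e_n_dir_unit norm_cis_scale
        real_sqrt_mult square_eq_1_iff)
  have sphere: "axis k 1 \<in> sphere (0 :: complex ^ 'n) 1" for k by (simp add: norm_axis_one)
  show ?thesis
  proof
    assume "horizontal_arclength TYPE('n) I x t"
    then obtain \<theta> where \<theta>: "horizontal_angle I x t \<theta>"
      and 1: "\<forall>s\<in>I. \<forall>\<omega> :: complex ^ 'n \<in> sphere 0 1. let v = deriv_in I (horizontal_curve x t \<theta> \<omega>) s
           in sqrt (levi_metric (horizontal_curve x t \<theta> \<omega> s) v v) = 1"
      unfolding horizontal_arclength_def by blast
    show "\<forall>s\<in>I. speed s = 1"
    proof
      fix s assume s: "s \<in> I"
      show "speed s = 1"
        using bspec[OF bspec[OF 1 s] sphere] unfolding *[OF \<theta> s norm_axis_one] .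
    qed
  next
    assume 1: "\<forall>s\<in>I. speed s = 1"
    obtain \<theta> where \<theta>: "horizontal_angle I x t \<theta>" using angle by blast
    have "\<forall>s\<in>I. \<forall>\<omega> :: complex ^ 'n \<in> sphere 0 1. let v = deriv_in I (horizontal_curve x t \<theta> \<omega>) s
         in sqrt (levi_metric (horizontal_curve x t \<theta> \<omega> s) v v) = 1"
    proof (intro ballI)
      fix s and \<omega> :: "complex ^ 'n" assume "s \<in> I" "\<omega> \<in> sphere 0 1"
      then show "let v = deriv_in I (horizontal_curve x t \<theta> \<omega>) s
         in sqrt (levi_metric (horizontal_curve x t \<theta> \<omega> s) v v) = 1"
        using *[OF \<theta>, of s \<omega>] 1 by simp
    qed
    then show "horizontal_arclength TYPE('n) I x t"
      unfolding horizontal_arclength_def using \<theta> by (intro exI conjI)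
  qed
qed

text \<open>
  Modulo \<open>xi'\<close> the horizontal tangent space is one-dimensional, so the unit normal of \<open>xi'\<close> in it is
  determined up to sign, and the horizontal curve selects the sign.
\<close>

lemma e_n_eq:
  fixes \<omega> :: "complex ^ 'n::finite"
  assumes s: "s \<in> I" and \<omega>: "norm \<omega> = 1"
  shows "e_n I x t s \<omega> = (e_n_dir s \<omega>, x s * sin_slope s)"
proof -
  let ?h = "e_n_dir s \<omega>"
  have hh: "?h \<bullet> ?h = 1" using e_n_dir_unit[OF s \<omega>] .
  obtain \<theta>0 where "horizontal_angle I x t \<theta>0" using angle by blast
  then have "horizontal_angle I x t (\<lambda>u. \<theta>0 u - \<theta>0 s)"
    unfolding horizontal_angle_def using DERIV_diff[OF _ DERIV_const] by fastforce
  then have ex: "\<exists>\<theta>. horizontal_angle I x t \<theta> \<and> \<theta> s = 0" 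
    by (intro exI[of _ "\<lambda>u. \<theta>0 u - \<theta>0 s"]) simp
  have vel: "fst (deriv_in I (horizontal_curve x t \<theta> \<omega>) s) = speed s *\<^sub>R ?h"
    if "horizontal_angle I x t \<theta>" "\<theta> s = 0" for \<theta>
    using horizontal_curve_velocity[OF s that(1), of \<omega>] that(2) by simp
  have im: "imul \<omega> \<bullet> ?h = - sin_slope s"
    using \<omega> by (simp add: e_n_dir_def inner_diff_right inner_imul_imul norm_eq_1)
  show ?thesis unfolding e_n_def Let_def
  proof (rule the_equality)
    show "(?h, x s * sin_slope s) \<in> horizontal_tangent I x t s \<omega> \<and>
      (\<forall>w\<in>xi' I x t s \<omega>. levi_metric (rot_param x t (s, \<omega>)) (?h, x s * sin_slope s) w = 0) \<and>
      levi_metric (rot_param x t (s, \<omega>)) (?h, x s * sin_slope s) (?h, x s * sin_slope s) = 1 \<and>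
      (\<exists>\<theta>. horizontal_angle I x t \<theta> \<and> \<theta> s = 0 \<and>
         0 < levi_metric (rot_param x t (s, \<omega>)) (?h, x s * sin_slope s)
               (deriv_in I (horizontal_curve x t \<theta> \<omega>) s))"
    proof (intro conjI ballI)
      show "(?h, x s * sin_slope s) \<in> horizontal_tangent I x t s \<omega>"
        by (simp add: horizontal_tangent_eq[OF s \<omega>] im)
      show "levi_metric (rot_param x t (s, \<omega>)) (?h, x s * sin_slope s) w = 0"
        if "w \<in> xi' I x t s \<omega>" for w
        using that orthogonal_e_n_dir_iff[OF s, of \<omega> "fst w"] by (simp add: xi'_eq[OF s \<omega>] levi_metric_eq)
      show "levi_metric (rot_param x t (s, \<omega>)) (?h, x s * sin_slope s) (?h, x s * sin_slope s) = 1"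
        by (simp add: levi_metric_eq hh)
      show "\<exists>\<theta>. horizontal_angle I x t \<theta> \<and> \<theta> s = 0 \<and>
         0 < levi_metric (rot_param x t (s, \<omega>)) (?h, x s * sin_slope s)
               (deriv_in I (horizontal_curve x t \<theta> \<omega>) s)"
      proof -
        obtain \<theta> where \<theta>: "horizontal_angle I x t \<theta>" "\<theta> s = 0" using ex by blast
        then show ?thesis
          using vel[OF \<theta>] hh speed_pos[OF s] by (intro exI[of _ \<theta>]) (simp add: levi_metric_eq)
      qed
    qed
  next
    fix v
    assume v: "v \<in> horizontal_tangent I x t s \<omega> \<and>
      (\<forall>w\<in>xi' I x t s \<omega>. levi_metric (rot_param x t (s, \<omega>)) v w = 0) \<and>
      levi_metric (rot_param x t (s, \<omega>)) v v = 1 \<and>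
      (\<exists>\<theta>. horizontal_angle I x t \<theta> \<and> \<theta> s = 0 \<and>
         0 < levi_metric (rot_param x t (s, \<omega>)) v (deriv_in I (horizontal_curve x t \<theta> \<omega>) s))"
    \<comment> \<open>The part \<open>\<eta>\<close> of \<open>v\<close> beyond its \<open>e_n\<close> component lies in \<open>xi'\<close> and is orthogonal to itself.\<close>
    define a where "a = ?h \<bullet> fst v"
    define \<eta> where "\<eta> = fst v - a *\<^sub>R ?h"
    have v1: "imul ?h \<bullet> fst v = 0" "snd v = - (x s * (imul \<omega> \<bullet> fst v))" "fst v \<bullet> fst v = 1"
      using v by (simp_all add: horizontal_tangent_eq[OF s \<omega>] levi_metric_eq)
    have "0 < fst v \<bullet> (speed s *\<^sub>R ?h)"
      using v vel by (auto simp: levi_metric_eq)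
    then have a: "a > 0"
      using speed_pos[OF s] by (simp add: a_def inner_commute zero_less_mult_iff)
    have "?h \<bullet> \<eta> = 0" "imul ?h \<bullet> \<eta> = 0"
      using v1 hh by (simp_all add: \<eta>_def a_def inner_diff_right)
    then have "(\<eta>, 0) \<in> xi' I x t s \<omega>" and h\<eta>: "?h \<bullet> \<eta> = 0"
      using orthogonal_e_n_dir_iff[OF s, of \<omega> \<eta>] by (simp_all add: xi'_eq[OF s \<omega>])
    then have "fst v \<bullet> \<eta> = 0" using v by (fastforce simp: levi_metric_eq)
    then have "\<eta> \<bullet> \<eta> = 0" using h\<eta> by (simp add: \<eta>_def inner_diff_left)
    then have fv: "fst v = a *\<^sub>R ?h" by (simp add: \<eta>_def)
    then have "a * a = 1" using v1(3) hh by simp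
    then have "a = 1" using a by (simp add: square_eq_1_iff)
    then show "v = (?h, x s * sin_slope s)" using fv v1(2) im by (simp add: prod_eq_iff)
  qed
qed

lemma e_2n_eq:
  fixes \<omega> :: "complex ^ 'n::finite"
  assumes s: "s \<in> I" and \<omega>: "norm \<omega> = 1"
  shows "e_2n I x t s \<omega> = (imul (e_n_dir s \<omega>), - (x s * cos_slope s))"
  using \<omega> by (simp add: e_2n_def e_n_eq[OF s \<omega>] heis_J_eq)
    (simp add: e_n_dir_def inner_diff_right norm_eq_1)

section \<open>The invariants in terms of the profile\<close>

text \<open>
  Inserting \<open>a e_2n + T\<close> into the determinant of \<open>tangent_space_eq\<close> gives an equation linear in \<open>a\<close>
  whose leading coefficient is \<open>x (cos\<^sup>2 \<phi> + sin\<^sup>2 \<phi>) = x\<close>; it has exactly one solution, which does not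
  depend on \<open>\<omega>\<close>.
\<close>

lemma alpha_eq:
  assumes s: "s \<in> I"
  shows "alpha TYPE('n::finite) I x t s = cos_slope s / x s"
proof -
  have *: "a *\<^sub>R e_2n I x t s \<omega> + frame_T \<in> tangent_space I x t s \<omega> \<longleftrightarrow> a = cos_slope s / x s"
    if \<omega>: "norm \<omega> = 1" for a and \<omega> :: "complex ^ 'n"
  proof -
    have "a *\<^sub>R e_2n I x t s \<omega> + frame_T \<in> tangent_space I x t s \<omega> \<longleftrightarrow>
        a * sin_slope s * dt s = dx s * (1 - a * (x s * cos_slope s))"
      using \<omega> by (simp add: tangent_space_eq[OF s \<omega>] e_2n_eq[OF s \<omega>] frame_T_def imul_e_n_dir
          inner_add_right norm_eq_1)
    also have "\<dots> \<longleftrightarrow> a * sin_slope s * (x s * sin_slope s) = cos_slope s * (1 - a * (x s * cos_slope s))"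
    proof -
      have "a * sin_slope s * dt s = speed s * (a * sin_slope s * (x s * sin_slope s))"
        "dx s * (1 - a * (x s * cos_slope s)) = speed s * (cos_slope s * (1 - a * (x s * cos_slope s)))"
        unfolding dx_eq[OF s] dt_eq[OF s] by (simp_all add: ac_simps)
      then show ?thesis using speed_pos[OF s] by (metis less_irrefl mult_cancel_left)
    qed
    also have "\<dots> \<longleftrightarrow> a * x s = cos_slope s"
    proof -
      have "a * sin_slope s * (x s * sin_slope s) - cos_slope s * (1 - a * (x s * cos_slope s)) =
        a * x s * ((cos_slope s)\<^sup>2 + (sin_slope s)\<^sup>2) - cos_slope s" by algebra
      then show ?thesis unfolding slope_unit[OF s] by auto
    qed
    also have "\<dots> \<longleftrightarrow> a = cos_slope s / x s"
      using pos[OF s] by (auto simp: field_simps)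
    finally show ?thesis .
  qed
  show ?thesis unfolding alpha_def
  proof (rule the_equality)
    show "\<forall>\<omega> :: complex ^ 'n \<in> sphere 0 1.
        (cos_slope s / x s) *\<^sub>R e_2n I x t s \<omega> + frame_T \<in> tangent_space I x t s \<omega>"
      using *[THEN iffD2, OF _ refl] by simp
  next
    fix a assume a: "\<forall>\<omega> :: complex ^ 'n \<in> sphere 0 1.
        a *\<^sub>R e_2n I x t s \<omega> + frame_T \<in> tangent_space I x t s \<omega>"
    have "axis undefined 1 \<in> sphere (0 :: complex ^ 'n) 1" by (simp add: norm_axis_one)
    then show "a = cos_slope s / x s" using bspec[OF a] *[OF norm_axis_one] by blast
  qed
qed

lemma slopes_differentiable:
  assumes s: "s \<in> I"
  obtains c' d' where "(cos_slope has_real_derivative c') (at s within I)"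
    "(sin_slope has_real_derivative d') (at s within I)"
proof -
  define q where "q u = (dx u)\<^sup>2 + (dt u / x u)\<^sup>2" for u
  obtain q' where q: "(q has_real_derivative q') (at s within I)"
    unfolding q_def using DERIV_add[OF DERIV_power[OF ddx[OF s]]
        DERIV_power[OF DERIV_divide[OF ddt[OF s] dx[OF s]]]] pos[OF s] by force
  have "q s > 0" using speed_pos[OF s] by (simp add: q_def speed_def)
  moreover have "speed = (\<lambda>u. sqrt (q u))" by (simp add: fun_eq_iff speed_def q_def)
  ultimately obtain l where l: "(speed has_real_derivative l) (at s within I)"
    using DERIV_chain2[OF DERIV_real_sqrt q] by auto
  have "\<exists>c'. (cos_slope has_real_derivative c') (at s within I)"
    using DERIV_divide[OF ddx[OF s] l] speed_pos[OF s] unfolding cos_slope_def[abs_def] by force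
  moreover have "\<exists>d'. (sin_slope has_real_derivative d') (at s within I)"
    using DERIV_divide[OF ddt[OF s] DERIV_mult[OF dx[OF s] l]] speed_pos[OF s] pos[OF s]
    unfolding sin_slope_def[abs_def] by force
  ultimately show ?thesis using that by blast
qed

text \<open>
  Vectors \<open>(\<eta>, 0)\<close> in \<open>xi'\<close> have neither a radial nor a vertical component. As \<open>(x', t')\<close> is nonzero, the profile
  parameter is stationary and only \<open>\<omega>\<close> moves, with velocity \<open>\<eta> / x\<close>.
\<close>

lemma surface_curve_velocity_xi':
  fixes \<omega> :: "complex ^ 'n::finite"
  assumes s: "s \<in> I" and \<omega>: "norm \<omega> = 1" and v: "v \<in> xi' I x t s \<omega>"
    and c: "surface_curve I x t s \<omega> c v"
  shows "(c has_vector_derivative (0, fst v /\<^sub>R x s)) (at_right 0)"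
proof -
  obtain \<sigma> \<mu> where c': "(c has_vector_derivative (\<sigma>, \<mu>)) (at_right 0)" and \<mu>: "\<omega> \<bullet> \<mu> = 0"
    and v': "v = ((dx s * \<sigma>) *\<^sub>R \<omega> + x s *\<^sub>R \<mu>, dt s * \<sigma>)"
    using surface_curve_velocity[OF s \<omega> c] .
  have "\<omega> \<bullet> fst v = 0" "snd v = 0" using v by (simp_all add: xi'_eq[OF s \<omega>])
  then have "dx s * \<sigma> = 0" "dt s * \<sigma> = 0"
    using v' \<mu> \<omega> by (auto simp: inner_add_right norm_eq_1)
  then have "\<sigma> = 0" using regular[OF s] by auto
  then show ?thesis using c' v' pos[OF s] by simp
qed

text \<open>
  The frame coefficients of \<open>e_2n\<close> are \<open>\<i> e\<^sup>-\<^sup>i\<^sup>\<phi> \<omega>\<close> and \<open>0\<close>. The profile parameter being stationary, the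
  derivative of \<open>\<phi>\<close> does not contribute and \<open>\<omega>\<close> is replaced by its velocity \<open>\<eta> / x\<close>, where \<open>v = (\<eta>, 0)\<close>. This depends on
  the curve only through \<open>v\<close>, so the shape operator is well defined on \<open>xi'\<close>.
\<close>

lemma cov_deriv_e_2n:
  fixes \<omega> :: "complex ^ 'n::finite"
  assumes s: "s \<in> I" and \<omega>: "norm \<omega> = 1" and v: "v \<in> xi' I x t s \<omega>"
    and c: "surface_curve I x t s \<omega> c v"
  shows "cov_deriv (\<lambda>u. rot_param x t (c u)) (\<lambda>u. e_2n I x t (fst (c u)) (snd (c u))) =
    ((cos_slope s / x s) *\<^sub>R imul (fst v) + (sin_slope s / x s) *\<^sub>R fst v, 0)"
proof -
  define \<mu> where "\<mu> = fst v /\<^sub>R x s"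
  have c': "(c has_vector_derivative (0, \<mu>)) (at_right 0)"
    unfolding \<mu>_def by (rule surface_curve_velocity_xi'[OF s \<omega> v c])
  have c0: "c 0 = (s, \<omega>)" and ev: "\<forall>\<^sub>F u in at_right 0. c u \<in> I \<times> sphere 0 1"
    using c by (auto simp: surface_curve_def)
  have evI: "\<forall>\<^sub>F u in at_right 0. fst (c u) \<in> I"
    by (use ev in \<open>auto elim!: eventually_mono\<close>)
  have 1: "((\<lambda>u. fst (c u)) has_vector_derivative 0) (at_right 0)"
    and 2: "((\<lambda>u. snd (c u)) has_vector_derivative \<mu>) (at_right 0)"
    using bounded_linear.has_vector_derivative[OF bounded_linear_fst c']
      bounded_linear.has_vector_derivative[OF bounded_linear_snd c'] by simp_all
  have i2: "((\<lambda>u. imul (snd (c u))) has_vector_derivative imul \<mu>) (at_right 0)"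
    by (rule bounded_linear.has_vector_derivative[OF bounded_linear_imul 2])
  obtain c1 d1 where sl: "(cos_slope has_real_derivative c1) (at s within I)"
    "(sin_slope has_real_derivative d1) (at s within I)"
    using slopes_differentiable[OF s] .
  have C: "((\<lambda>u. cos_slope (fst (c u))) has_vector_derivative 0) (at_right 0)"
    and S: "((\<lambda>u. sin_slope (fst (c u))) has_vector_derivative 0) (at_right 0)"
    using chain_rule_at_right_0[OF sl(1) 1] chain_rule_at_right_0[OF sl(2) 1] c0 s evI by simp_all
  define W where "W u = imul (e_n_dir (fst (c u)) (snd (c u)))" for u
  have W': "(W has_vector_derivative cos_slope s *\<^sub>R imul \<mu> + sin_slope s *\<^sub>R \<mu>) (at_right 0)"
    unfolding W_def imul_e_n_dir
    using has_vector_derivative_add[OF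
        bounded_bilinear.has_vector_derivative[OF bounded_bilinear_scaleR C i2]
        bounded_bilinear.has_vector_derivative[OF bounded_bilinear_scaleR S 2]] c0 by simp
  have fc: "frame_coeffs (rot_param x t (c u)) (e_2n I x t (fst (c u)) (snd (c u))) = (W u, 0)"
    if "c u \<in> I \<times> sphere 0 1" for u
  proof -
    obtain s' \<omega>' where c: "c u = (s', \<omega>')" by (cases "c u")
    have s': "s' \<in> I" and \<omega>': "norm \<omega>' = 1" using that c by auto
    have "\<omega>' \<bullet> e_n_dir s' \<omega>' = cos_slope s'"
      using \<omega>' by (simp add: e_n_dir_def inner_diff_right norm_eq_1)
    then show ?thesis
      using c by (simp add: frame_coeffs_def e_2n_eq[OF s' \<omega>'] contact_form_eq W_def
          imul_scaleR inner_imul_imul)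
  qed
  obtain d where d: "d > 0" "at_right 0 = at 0 within {0..<d}"
      "\<And>u. u \<in> {0..<d} \<Longrightarrow> c u \<in> I \<times> sphere 0 1"
    using at_right_0_within[OF ev] c0 s \<omega> by auto
  have "((\<lambda>u. (W u, 0::real)) has_vector_derivative
      (cos_slope s *\<^sub>R imul \<mu> + sin_slope s *\<^sub>R \<mu>, 0)) (at_right 0)"
    by (intro has_vector_derivative_pair W') simp
  then have "((\<lambda>u. frame_coeffs (rot_param x t (c u)) (e_2n I x t (fst (c u)) (snd (c u))))
      has_vector_derivative (cos_slope s *\<^sub>R imul \<mu> + sin_slope s *\<^sub>R \<mu>, 0)) (at_right 0)"
    unfolding d(2) by (rule has_vector_derivative_transform[rotated 2]) (use d fc in auto)
  then have vd: "vector_derivative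
      (\<lambda>u. frame_coeffs (rot_param x t (c u)) (e_2n I x t (fst (c u)) (snd (c u)))) (at_right 0) =
      (cos_slope s *\<^sub>R imul \<mu> + sin_slope s *\<^sub>R \<mu>, 0)"
    by (intro vector_derivative_within) simp_all
  have "\<omega> \<bullet> \<mu> = 0" "imul \<omega> \<bullet> \<mu> = 0"
    using v by (simp_all add: \<mu>_def xi'_eq[OF s \<omega>])
  then show ?thesis
    by (simp add: cov_deriv_def vd from_frame_eq contact_form_eq c0 imul_scaleR inner_add_right
        inner_imul_imul) (simp add: \<mu>_def imul_scaleR divide_inverse)
qed

text \<open>
  The covariant derivative has a component along \<open>J v\<close>, with coefficient \<open>cos \<phi> / x = \<alpha>\<close>. The
  correction \<open>\<alpha> J' v\<close> in the definition cancels exactly this component, leaving a multiple of \<open>v\<close>.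
\<close>

lemma shape_operator_xi':
  fixes \<omega> :: "complex ^ 'n::finite"
  assumes s: "s \<in> I" and \<omega>: "norm \<omega> = 1" and v: "v \<in> xi' I x t s \<omega>"
  shows "shape_operator I x t s \<omega> v = (- (sin_slope s / x s)) *\<^sub>R v"
proof -
  have v': "snd v = 0" "\<omega> \<bullet> fst v = 0" "imul \<omega> \<bullet> fst v = 0"
    using v by (simp_all add: xi'_eq[OF s \<omega>])
  have "fst v \<bullet> e_n_dir s \<omega> = 0"
    using orthogonal_e_n_dir_iff[OF s, of \<omega> "fst v"] v' by (simp add: inner_commute)
  then have J: "J' I x t s \<omega> v = (imul (fst v), 0)"
    using v' by (simp add: J'_def e_n_eq[OF s \<omega>] levi_metric_eq heis_J_eq)
  have *: "- cov_deriv (\<lambda>u. rot_param x t (c u)) (\<lambda>u. e_2n I x t (fst (c u)) (snd (c u)))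
            + alpha TYPE('n) I x t s *\<^sub>R J' I x t s \<omega> v = (- (sin_slope s / x s)) *\<^sub>R v"
    if "surface_curve I x t s \<omega> c v" for c
    using v'(1) by (simp add: cov_deriv_e_2n[OF s \<omega> v that] alpha_eq[OF s] J prod_eq_iff)
  obtain c where c: "surface_curve I x t s \<omega> c v"
    using orbit_surface_curve[OF s \<omega> v'(2)] v'(1) by (metis prod.collapse)
  show ?thesis unfolding shape_operator_def
  proof (rule the_equality)
    show "\<forall>c. surface_curve I x t s \<omega> c v \<longrightarrow> (- (sin_slope s / x s)) *\<^sub>R v =
      - cov_deriv (\<lambda>u. rot_param x t (c u)) (\<lambda>u. e_2n I x t (fst (c u)) (snd (c u)))
        + alpha TYPE('n) I x t s *\<^sub>R J' I x t s \<omega> v"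
      by (intro allI impI *[symmetric])
  next
    fix w
    assume "\<forall>c. surface_curve I x t s \<omega> c v \<longrightarrow> w =
      - cov_deriv (\<lambda>u. rot_param x t (c u)) (\<lambda>u. e_2n I x t (fst (c u)) (snd (c u)))
        + alpha TYPE('n) I x t s *\<^sub>R J' I x t s \<omega> v"
    from this[rule_format, OF c] show "w = (- (sin_slope s / x s)) *\<^sub>R v"
      unfolding *[OF c] .
  qed
qed

text \<open>
  For \<open>n \<ge> 2\<close> the space \<open>xi'\<close> is nonzero, so the eigenvalue is unique; for \<open>n = 1\<close> the defining formula
  agrees because \<open>sqrt ((x x')\<^sup>2 + t'\<^sup>2) = x L\<close>.
\<close>

lemma curv_k_eq:
  assumes s: "s \<in> I"
  shows "curv_k TYPE('n::finite) I x t s = - (sin_slope s / x s)"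
proof (cases "CARD('n) = 1")
  case True
  have "sqrt ((x s * dx s)\<^sup>2 + (dt s)\<^sup>2) = sqrt ((x s)\<^sup>2 * ((dx s)\<^sup>2 + (dt s / x s)\<^sup>2))"
    using pos[OF s] by (simp add: algebra_simps power_mult_distrib power_divide)
  also have "\<dots> = x s * speed s"
    unfolding real_sqrt_mult speed_def using pos[OF s] by simp
  finally show ?thesis
    using True by (simp add: curv_k_def deriv_in_dx[OF s] deriv_in_dt[OF s] sin_slope_def)
next
  case False
  obtain i j :: 'n where ij: "i \<noteq> j"
  proof (rule ccontr)
    assume "\<not> thesis"
    then have "UNIV = {undefined :: 'n}" using that by auto
    then show False using False by (metis card_1_singleton_iff One_nat_def)
  qed
  let ?\<omega> = "axis i 1 :: complex ^ 'n" and ?v = "(axis j 1, 0) :: 'n heis"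
  have \<omega>: "norm ?\<omega> = 1" by (simp add: norm_axis_one)
  have "?\<omega> \<bullet> axis j 1 = 0" "imul ?\<omega> \<bullet> axis j 1 = 0"
    using ij by (simp_all add: inner_axis) (simp_all add: axis_def)
  then have v: "?v \<in> xi' I x t s ?\<omega>" by (simp add: xi'_eq[OF s \<omega>])
  have "?v \<noteq> 0" by (simp add: prod_eq_iff)
  have "(THE \<kappa>. \<forall>\<omega> :: complex ^ 'n \<in> sphere 0 1. \<forall>v\<in>xi' I x t s \<omega>.
      shape_operator I x t s \<omega> v = \<kappa> *\<^sub>R v) = - (sin_slope s / x s)"
  proof (rule the_equality)
    fix \<kappa> assume "\<forall>\<omega> :: complex ^ 'n \<in> sphere 0 1. \<forall>v\<in>xi' I x t s \<omega>.
      shape_operator I x t s \<omega> v = \<kappa> *\<^sub>R v"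
    moreover have "?\<omega> \<in> sphere 0 1" using \<omega> by simp
    ultimately have "shape_operator I x t s ?\<omega> ?v = \<kappa> *\<^sub>R ?v" using v by blast
    then show "\<kappa> = - (sin_slope s / x s)"
      using scaleR_right_imp_eq[OF \<open>?v \<noteq> 0\<close>] shape_operator_xi'[OF s \<omega> v] by metis
  qed (use shape_operator_xi'[OF s] in auto)
  then show ?thesis using False by (simp add: curv_k_def)
qed

end

section \<open>Hypersurfaces with prescribed invariants\<close>

lemma vertical_translation_in_PSH: "heis_mult (0, c) \<in> PSH"
  unfolding PSH_def by (rule generate.incl) simp

lemma vertical_translation_apply: "heis_mult (0, c) p = (fst p, snd p + c)" for p :: "'n::finite heis"
  by (simp add: heis_mult_def)

lemma vertical_translation_rot_hypersurface:
  assumes "rot_hypersurface I x t S" "rot_hypersurface I X \<tau> S'"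
    and "\<And>s. s \<in> I \<Longrightarrow> X s = x s \<and> \<tau> s = t s + c"
  shows "heis_mult (0, c) ` S = S'"
proof -
  have S: "S = {p. \<exists>s\<in>I. norm (fst p) = x s \<and> snd p = t s}"
    using assms(1) by (simp add: rot_hypersurface_def)
  have "S' = {p. \<exists>s\<in>I. norm (fst p) = X s \<and> snd p = \<tau> s}"
    using assms(2) by (simp add: rot_hypersurface_def)
  also have "\<dots> = {p. \<exists>s\<in>I. norm (fst p) = x s \<and> snd p = t s + c}"
    using assms(3) by (intro Collect_cong bex_cong) auto
  finally have S': "S' = {p. \<exists>s\<in>I. norm (fst p) = x s \<and> snd p = t s + c}" .
  show ?thesis
  proof (intro equalityI subsetI)
    fix p assume "p \<in> S'"
    then have "(fst p, snd p - c) \<in> S" "p = heis_mult (0, c) (fst p, snd p - c)"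
      unfolding S S' by (auto simp: vertical_translation_apply)
    then show "p \<in> heis_mult (0, c) ` S" by blast
  qed (auto simp: S S' vertical_translation_apply)
qed

text \<open>
  The existence of the horizontal angle is part of having a horizontal arc-length, so every profile
  with the prescribed invariants falls under the computations above.
\<close>

lemma rotational_profileI:
  assumes I: "is_interval I" "interior I \<noteq> {}"
    and gen: "generating_curve I X \<tau>" and angle: "\<exists>\<theta>. horizontal_angle I X \<tau> \<theta>"
  obtains dX d\<tau> ddX dd\<tau> where "rotational_profile I X \<tau> dX d\<tau> ddX dd\<tau>"
proof -
  obtain A where A: "A 0 = X" "\<And>m s. s \<in> I \<Longrightarrow> (A m has_real_derivative A (Suc m) s) (at s within I)"
    using gen unfolding generating_curve_def smooth_on_interval_def by metis
  obtain B where B: "B 0 = \<tau>" "\<And>m s. s \<in> I \<Longrightarrow> (B m has_real_derivative B (Suc m) s) (at s within I)"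
    using gen unfolding generating_curve_def smooth_on_interval_def by metis
  have "rotational_profile I X \<tau> (A 1) (B 1) (A 2) (B 2)"
  proof
    fix s assume s: "s \<in> I"
    show dX: "(X has_real_derivative A 1 s) (at s within I)" and d\<tau>: "(\<tau> has_real_derivative B 1 s) (at s within I)"
      using A(2)[OF s, of 0] B(2)[OF s, of 0] A(1) B(1) by simp_all
    show "(A 1 has_real_derivative A 2 s) (at s within I)" "(B 1 has_real_derivative B 2 s) (at s within I)"
      using A(2)[OF s, of 1] B(2)[OF s, of 1] by (simp_all add: numeral_2_eq_2)
    show "X s > 0" "(A 1 s, B 1 s) \<noteq> (0, 0)"
      using gen s deriv_in_eq_real[OF I s dX] deriv_in_eq_real[OF I s d\<tau>]
      by (auto simp: generating_curve_def)
  qed (use I angle in auto)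
  then show ?thesis using that by blast
qed

text \<open>
  Once \<open>L = 1\<close>, the formulas for \<open>\<alpha>\<close> and \<open>k\<close> become the differential equations \<open>x' = \<alpha> x\<close> and
  \<open>t' = - k x\<^sup>2\<close>. The hypersurface is recovered from the profile as the set of its rotations.
\<close>

lemma has_invariants_iff:
  assumes I: "is_interval I" "interior I \<noteq> {}"
  shows "(\<exists>S :: 'n::finite heis set. has_invariants I a k X \<tau> S) \<longleftrightarrow>
    generating_curve I X \<tau> \<and> (\<exists>\<theta>. horizontal_angle I X \<tau> \<theta>) \<and>
    (\<forall>s\<in>I. (deriv_in I X s)\<^sup>2 + (deriv_in I \<tau> s / X s)\<^sup>2 = 1 \<and>
       deriv_in I X s = a s * X s \<and> deriv_in I \<tau> s = - (k s * (X s)\<^sup>2))"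
    (is "?L \<longleftrightarrow> ?G \<and> ?A \<and> ?E")
proof -
  have hyp: "rot_hypersurface I X \<tau> {p :: 'n heis. \<exists>s\<in>I. (norm (fst p), snd p) = (X s, \<tau> s)}" if ?G
    using that U_invariant_radial[of "\<lambda>r h. \<exists>s\<in>I. (r, h) = (X s, \<tau> s)"]
    by (simp add: rot_hypersurface_def)
  have G: ?G and A: ?A if ?L
    using that by (auto simp: has_invariants_def rot_hypersurface_def horizontal_arclength_def)
  have E: "(horizontal_arclength TYPE('n) I X \<tau> \<and>
      (\<forall>s\<in>I. alpha TYPE('n) I X \<tau> s = a s \<and> curv_k TYPE('n) I X \<tau> s = k s)) \<longleftrightarrow> ?E"
    if g: ?G and ang: ?A
  proof -
    obtain dX d\<tau> ddX dd\<tau> where "rotational_profile I X \<tau> dX d\<tau> ddX dd\<tau>"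
      using rotational_profileI[OF I g ang] .
    then interpret rotational_profile I X \<tau> dX d\<tau> ddX dd\<tau> .
    have "(speed s = 1 \<and> alpha TYPE('n) I X \<tau> s = a s \<and> curv_k TYPE('n) I X \<tau> s = k s) \<longleftrightarrow>
      ((deriv_in I X s)\<^sup>2 + (deriv_in I \<tau> s / X s)\<^sup>2 = 1 \<and>
       deriv_in I X s = a s * X s \<and> deriv_in I \<tau> s = - (k s * (X s)\<^sup>2))" if s: "s \<in> I" for s
    proof -
      have sp: "speed s = 1 \<longleftrightarrow> (dX s)\<^sup>2 + (d\<tau> s / X s)\<^sup>2 = 1"
        by (simp add: speed_def)
      have "cos_slope s / X s = a s \<longleftrightarrow> dX s = a s * X s"
        "- (sin_slope s / X s) = k s \<longleftrightarrow> d\<tau> s = - (k s * (X s)\<^sup>2)" if "speed s = 1"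
        using that pos[OF s] by (auto simp: cos_slope_def sin_slope_def field_simps power2_eq_square)
      then show ?thesis
        unfolding sp[symmetric] deriv_in_dx[OF s] deriv_in_dt[OF s] alpha_eq[OF s] curv_k_eq[OF s]
        using sp by blast
    qed
    then show ?thesis unfolding horizontal_arclength_iff by blast
  qed
  show ?thesis
    using hyp G A E unfolding has_invariants_def by blast
qed

theorem theoremI:
  fixes I :: "real set" and abar kbar F x t :: "real \<Rightarrow> real"
  assumes I: "is_interval I" "interior I \<noteq> {}"
    and abar: "smooth_on_interval I abar"
    and kbar: "smooth_on_interval I kbar"
    and F: "\<And>s. s \<in> I \<Longrightarrow> (F has_real_derivative abar s) (at s within I)"
    and x: "\<And>s. x s = exp (F s)"
    and t: "\<And>s. s \<in> I \<Longrightarrow> (t has_real_derivative - (kbar s * (x s)\<^sup>2)) (at s within I)"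
    and integrability: "\<And>s. s \<in> I \<Longrightarrow>
      ((x s * deriv_in I x s)\<^sup>2 + (deriv_in I t s)\<^sup>2) / (x s)\<^sup>2 = 1"
  shows "(\<exists>X \<tau>. \<exists>S :: 'n::finite heis set. has_invariants I abar kbar X \<tau> S) \<and>
    (\<forall>X\<^sub>1 \<tau>\<^sub>1 X\<^sub>2 \<tau>\<^sub>2. \<forall>S\<^sub>1 S\<^sub>2 :: 'n heis set.
       has_invariants I abar kbar X\<^sub>1 \<tau>\<^sub>1 S\<^sub>1 \<and> has_invariants I abar kbar X\<^sub>2 \<tau>\<^sub>2 S\<^sub>2 \<longrightarrow>
       (\<exists>\<phi>\<in>PSH. \<phi> ` S\<^sub>1 = S\<^sub>2)) \<and>
    (\<forall>X \<tau>. (\<exists>S :: 'n heis set. has_invariants I abar kbar X \<tau> S) \<longleftrightarrow>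
       (\<forall>s\<in>I. X s = x s) \<and> (\<exists>c. \<forall>s\<in>I. \<tau> s = t s + c))"
proof -
  have xpos: "x s > 0" for s by (simp add: x)
  have x': "(x has_real_derivative abar s * x s) (at s within I)" if "s \<in> I" for s
    using DERIV_chain2[OF DERIV_exp F[OF that]] by (simp add: x[abs_def] mult.commute)
  have unit: "(abar s * x s)\<^sup>2 + (kbar s * x s)\<^sup>2 = 1" if s: "s \<in> I" for s
  proof -
    have "((x s * (abar s * x s))\<^sup>2 + (- (kbar s * (x s)\<^sup>2))\<^sup>2) / (x s)\<^sup>2 = 1"
      using integrability[OF s] deriv_in_eq_real[OF I s x'[OF s]] deriv_in_eq_real[OF I s t[OF s]]
      by simp
    moreover have "((x s * (abar s * x s))\<^sup>2 + (- (kbar s * (x s)\<^sup>2))\<^sup>2) / (x s)\<^sup>2 =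
        (abar s * x s)\<^sup>2 + (kbar s * x s)\<^sup>2"
      using xpos[of s] by (simp add: field_simps power2_eq_square)
    ultimately show ?thesis by simp
  qed
  have char: "(\<exists>S :: 'n heis set. has_invariants I abar kbar X \<tau> S) \<longleftrightarrow>
       (\<forall>s\<in>I. X s = x s) \<and> (\<exists>c. \<forall>s\<in>I. \<tau> s = t s + c)" for X \<tau>
  proof
    assume "\<exists>S :: 'n heis set. has_invariants I abar kbar X \<tau> S"
    then have gen: "generating_curve I X \<tau>"
      and E: "\<forall>s\<in>I. (deriv_in I X s)\<^sup>2 + (deriv_in I \<tau> s / X s)\<^sup>2 = 1 \<and>
       deriv_in I X s = abar s * X s \<and> deriv_in I \<tau> s = - (kbar s * (X s)\<^sup>2)"
      using has_invariants_iff[OF I, where 'n='n] by blast+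
    have Xpos: "X s > 0" if "s \<in> I" for s using gen that by (simp add: generating_curve_def)
    have d: "(f has_real_derivative deriv_in I f s) (at s within I)"
      if "smooth_on_interval I f" "s \<in> I" for f s
      using that deriv_in_eq_real[OF I] unfolding smooth_on_interval_def by metis
    have X': "(X has_real_derivative abar s * X s) (at s within I)"
      and \<tau>': "(\<tau> has_real_derivative - (kbar s * (X s)\<^sup>2)) (at s within I)" if "s \<in> I" for s
      using d[of X s] d[of \<tau> s] E that gen by (simp_all add: generating_curve_def)
    have Xunit: "(abar s * X s)\<^sup>2 + (kbar s * X s)\<^sup>2 = 1" if s: "s \<in> I" for s
    proof -
      have "deriv_in I \<tau> s / X s = - (kbar s * X s)"
        using E s Xpos[OF s] by (simp add: power2_eq_square)
      then show ?thesis using E s by (metis power2_minus)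
    qed
    \<comment> \<open>The unit speed condition determines the square of the radius.\<close>
    have X: "X s = x s" if s: "s \<in> I" for s
    proof -
      have "(x s)\<^sup>2 * ((abar s)\<^sup>2 + (kbar s)\<^sup>2) = 1" "(X s)\<^sup>2 * ((abar s)\<^sup>2 + (kbar s)\<^sup>2) = 1"
        using unit[OF s] Xunit[OF s] by (simp_all add: power_mult_distrib algebra_simps)
      then have "(X s)\<^sup>2 = (x s)\<^sup>2" by (metis mult_cancel_right mult_zero_right zero_neq_one)
      then show ?thesis using xpos[of s] Xpos[OF s] by (simp add: power2_eq_iff_nonneg)
    qed
    have "((\<lambda>s. \<tau> s - t s) has_real_derivative 0) (at s within I)" if s: "s \<in> I" for s
      using DERIV_diff[OF \<tau>'[OF s] t[OF s]] X[OF s] by simp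
    then obtain c where "\<forall>s\<in>I. \<tau> s - t s = c"
      using has_field_derivative_zero_constant[OF is_interval_convex[OF I(1)]] by blast
    then have "\<forall>s\<in>I. \<tau> s = t s + c" by (auto simp: algebra_simps)
    then show "(\<forall>s\<in>I. X s = x s) \<and> (\<exists>c. \<forall>s\<in>I. \<tau> s = t s + c)" using X by blast
  next
    assume "(\<forall>s\<in>I. X s = x s) \<and> (\<exists>c. \<forall>s\<in>I. \<tau> s = t s + c)"
    then obtain c where X: "\<And>s. s \<in> I \<Longrightarrow> X s = x s" and \<tau>: "\<And>s. s \<in> I \<Longrightarrow> \<tau> s = t s + c" by blast
    have X': "(X has_real_derivative abar s * X s) (at s within I)" if s: "s \<in> I" for s
      using has_real_derivative_transform[OF x'[OF s] s X] X[OF s] by simp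
    have "((\<lambda>s. t s + c) has_real_derivative - (kbar s * (x s)\<^sup>2)) (at s within I)" if s: "s \<in> I" for s
      using DERIV_add[OF t[OF s] DERIV_const] by simp
    then have \<tau>': "(\<tau> has_real_derivative - (kbar s * (X s)\<^sup>2)) (at s within I)" if s: "s \<in> I" for s
      using has_real_derivative_transform[OF _ s \<tau>] X s by simp
    have dX: "deriv_in I X s = abar s * X s" and d\<tau>: "deriv_in I \<tau> s = - (kbar s * (X s)\<^sup>2)" if s: "s \<in> I" for s
      using deriv_in_eq_real[OF I s X'[OF s]] deriv_in_eq_real[OF I s \<tau>'[OF s]] by auto
    have Xpos: "X s > 0" if "s \<in> I" for s using X that xpos by simp
    have Xunit: "(abar s * X s)\<^sup>2 + (kbar s * X s)\<^sup>2 = 1" if s: "s \<in> I" for s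
      using unit[OF s] X[OF s] by simp
    have smX: "smooth_on_interval I X" by (rule smooth_solution_linear_ode[OF I abar X'])
    have "smooth_on_interval I (\<lambda>s. - 1 * (kbar s * (X s * X s)))"
      by (intro smooth_on_interval_mult smooth_on_interval_const I kbar smX)
    then have sm\<tau>: "smooth_on_interval I \<tau>"
      by (rule smooth_on_interval_antiderivative[OF I]) (use \<tau>' in \<open>simp add: power2_eq_square\<close>)
    have "generating_curve I X \<tau>"
      unfolding generating_curve_def
    proof (intro conjI ballI smX sm\<tau>)
      fix s assume s: "s \<in> I"
      show "X s > 0" by (rule Xpos[OF s])
      then show "(deriv_in I X s, deriv_in I \<tau> s) \<noteq> (0, 0)"
        using Xunit[OF s] by (auto simp: dX[OF s] d\<tau>[OF s])
    qed
    \<comment> \<open>Since \<open>t' = - k x\<^sup>2\<close>, the horizontal angle has to be an antiderivative of \<open>k\<close>.\<close>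
    moreover obtain \<theta> where \<theta>: "\<And>s. s \<in> I \<Longrightarrow> (\<theta> has_real_derivative kbar s) (at s within I)"
      using antiderivative_on_interval[OF I(1) smooth_imp_continuous_on[OF kbar]] by blast
    have "horizontal_angle I X \<tau> \<theta>"
      unfolding horizontal_angle_def
    proof
      fix s assume s: "s \<in> I"
      show "(\<theta> has_real_derivative - deriv_in I \<tau> s / (X s)\<^sup>2) (at s within I)"
        using \<theta>[OF s] Xpos[OF s] by (simp add: d\<tau>[OF s])
    qed
    moreover have "(deriv_in I X s)\<^sup>2 + (deriv_in I \<tau> s / X s)\<^sup>2 = 1" if s: "s \<in> I" for s
      using Xunit[OF s] Xpos[OF s] by (simp add: dX[OF s] d\<tau>[OF s] power2_eq_square)
    ultimately show "\<exists>S :: 'n heis set. has_invariants I abar kbar X \<tau> S"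
      unfolding has_invariants_iff[OF I] using dX d\<tau> by blast
  qed
  have rigid: "\<exists>\<phi>\<in>PSH. \<phi> ` S1 = S2"
    if h: "has_invariants I abar kbar X1 \<tau>1 S1" "has_invariants I abar kbar X2 \<tau>2 S2"
    for X1 \<tau>1 X2 \<tau>2 and S1 S2 :: "'n heis set"
  proof -
    obtain c1 where 1: "\<forall>s\<in>I. X1 s = x s" "\<forall>s\<in>I. \<tau>1 s = t s + c1" using char h(1) by blast
    obtain c2 where 2: "\<forall>s\<in>I. X2 s = x s" "\<forall>s\<in>I. \<tau>2 s = t s + c2" using char h(2) by blast
    have "heis_mult (0, c2 - c1) ` S1 = S2"
    proof (rule vertical_translation_rot_hypersurface)
      show "rot_hypersurface I X1 \<tau>1 S1" "rot_hypersurface I X2 \<tau>2 S2"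
        using h by (simp_all add: has_invariants_def)
      show "X2 s = X1 s \<and> \<tau>2 s = \<tau>1 s + (c2 - c1)" if "s \<in> I" for s
        using 1 2 that by simp
    qed
    then show ?thesis using vertical_translation_in_PSH by blast
  qed
  have "\<exists>X \<tau>. \<exists>S :: 'n heis set. has_invariants I abar kbar X \<tau> S"
    using char[of x t] by (metis add_0_right)
  then show ?thesis using char rigid by blast
qed

end
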